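(* For $k\in\mathbb N$ and $q\in(0,1)$ let $x_k(q)$ be the $k$-th zero (in decreasing order, $\cdots<x_2(q)<x_1(q)<0$) of $f(x;q)=\sum_{n\ge0}\frac{x^n}{n!}q^{n(n-1)/2}$, and let $w_k(q):=-q^{k-1}x_k(q)/k$. The function $w_k$ extends analytically to a neighbourhood of $q=0$ with $w_k(0)=1$; define the coefficients $a_{k,n}$, $\hat a_{k,n}$ ($n\ge1$) by the expansions \[ w_k(q)=1+\sum_{n\ge1}a_{k,n}q^n,\qquad \frac{1}{w_k(q)}=1-\sum_{n\ge1}\hat a_{k,n}q^n \] near $q=0$. For $n,l\ge1$ let $\gamma_{n,l}=\lfloor 2n/(l(l+1))\rfloor$, $Q_n(x)=x^n\prod_{l\ge1}(x+l)^{\gamma_{n,l}}$, $\mu_j(n)=\sum_{l\ge1}l^j\gamma_{n,l}$, and $M_n=\deg(Q_n)=\mu_0(n)+n$. Let $\sigma(n)=\sum_{d\mid n}d$. Then: (i) There exist polynomials $P_n,\widehat P_n\in\mathbb Z[x]$ ($n\ge1$) such that for all $k,n\ge1$, \[ a_{k,n}=\frac{P_n(k)}{Q_n(k)},\qquad \hat a_{k,n}=\frac{\widehat P_n(k)}{Q_n(k)}. \] (ii) $M_n<3n$ for all $n\ge1$, and $M_n/n\to3$ as $n\to\infty$. For $n\ge2$, each of the polynomials $P_n$ and $\widehat P_n$ has the form \[ \sigma(n)k^{M_n-2}+\sigma(n)\bigl(\mu_1(n)-n\bigr)k^{M_n-3}+\text{(terms of degree at most } M_n-4), \] and the coefficient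 $\sigma(n)(\mu_1(n)-n)$ is zero for $n=2$ and positive for all $n\ge3$.
   Context: For $q\in(0,1)$ the zeros of $f(\cdot;q)$ are infinitely many, simple and negative. It is known (Sokal) that for $0<|q|<0.207875$ each $x_k$ is analytic with a Laurent expansion of the form $x_k(q)=-kq^{1-k}(1+O(q))$, so that $w_k$ is analytic near $0$ with $w_k(0)=1$. Note $\gamma_{n,l}=0$ for $l\ge\sqrt{2n}$, so $Q_n\in\mathbb Z[x]$ is a polynomial. *)

theory Defs
  imports Complex_Main "HOL-Computational_Algebra.Polynomial"
begin

definition fpt :: "real \<Rightarrow> real \<Rightarrow> real" where
  "fpt x q = (\<Sum>n. x ^ n / fact n * q ^ (n * (n - 1) div 2))"

definition xz :: "nat \<Rightarrow> real \<Rightarrow> real" where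
  "xz k q = (THE x. fpt x q = 0 \<and> finite {y. x < y \<and> fpt y q = 0}
                 \<and> card {y. x < y \<and> fpt y q = 0} = k - 1)"

definition w :: "nat \<Rightarrow> real \<Rightarrow> real" where
  "w k q = - (q ^ (k - 1)) * xz k q / real k"

text \<open>Taylor coefficients at q = 0 of (the analytic extension of) w_k and 1/w_k,
  characterised as the coefficients of a power series converging to them on
  some interval (0,r).\<close>
definition wcoef :: "nat \<Rightarrow> nat \<Rightarrow> real" where
  "wcoef k = (SOME c. \<exists>r>0. r \<le> 1 \<and>
       (\<forall>q. 0 < q \<and> q < r \<longrightarrow> (\<lambda>n. c n * q ^ n) sums w k q))"

definition winvcoef :: "nat \<Rightarrow> nat \<Rightarrow> real" where
  "winvcoef k = (SOME c. \<exists>r>0. r \<le> 1 \<and>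
       (\<forall>q. 0 < q \<and> q < r \<longrightarrow> (\<lambda>n. c n * q ^ n) sums (1 / w k q)))"

text \<open>w_k(q) = 1 + sum a_{k,n} q^n and 1/w_k(q) = 1 - sum ahat_{k,n} q^n.\<close>
definition a :: "nat \<Rightarrow> nat \<Rightarrow> real" where
  "a k n = wcoef k n"

definition ahat :: "nat \<Rightarrow> nat \<Rightarrow> real" where
  "ahat k n = - winvcoef k n"

definition gam :: "nat \<Rightarrow> nat \<Rightarrow> nat" where
  "gam n l = (2 * n) div (l * (l + 1))"

text \<open>gamma_{n,l} = 0 for l > n, so the products/sums over l >= 1 are over {1..n}.\<close>
definition Q :: "nat \<Rightarrow> int poly" where
  "Q n = monom 1 n * (\<Prod>l\<in>{1..n}. [:int l, 1:] ^ gam n l)"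

definition mu :: "nat \<Rightarrow> nat \<Rightarrow> nat" where
  "mu j n = (\<Sum>l\<in>{1..n}. l ^ j * gam n l)"

definition M :: "nat \<Rightarrow> nat" where
  "M n = mu 0 n + n"

definition sigma :: "nat \<Rightarrow> nat" where
  "sigma n = (\<Sum>d\<in>{d. d dvd n}. d)"

end

theory Submission
  imports "HOL-Complex_Analysis.Complex_Analysis" Defs
begin

text \<open>
  Substituting \<open>x = - k w / q\<^bsup>k-1\<^esup>\<close> and normalising the two dominant terms of \<open>f(x; q)\<close> turns
  \<open>f(x; q) = 0\<close> into
  \<open>w - 1 + \<Sum>\<^sub>l\<^sub>\<ge>\<^sub>1 (-1)\<^sup>l q\<^bsup>l(l+1)/2\<^esup> (A\<^sub>l w\<^bsup>l+1\<^esup> - B\<^sub>l w\<^bsup>-l\<^esup>) = 0\<close> with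
  \<open>A\<^sub>l = \<Prod>\<^sub>i\<^sub>\<le>\<^sub>l k / (k + i)\<close> and \<open>B\<^sub>l = \<Prod>\<^sub>i\<^sub>\<le>\<^sub>l (k - i) / k\<close>. For small \<open>q\<close> this is a fixed point
  equation for a contraction of \<open>1/4 \<le> |w| \<le> 4\<close>, so it has a unique solution there, holomorphic in \<open>q\<close>;
  a zero \<open>x\<close> not of this form for any \<open>k\<close> would leave one term of the series larger than all the others
  together.

  The coefficient of \<open>q\<^sup>n\<close> in \<open>w\<close> is a polynomial in the \<open>A\<^sub>l\<close> and \<open>B\<^sub>l\<close> that is homogeneous of degree \<open>n\<close>
  when these get weight \<open>l(l+1)/2\<close>. At most \<open>\<gamma>\<^sub>n\<^sub>,\<^sub>j\<close> factors in a monomial have index \<open>l \<ge> j\<close>, whence the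
  denominator \<open>Q\<^sub>n\<close>.

  For \<open>e = 1/k \<rightarrow> 0\<close> one has \<open>w = 1 + O(e\<^sup>2)\<close>. With \<open>J = \<Sum>\<^sub>l (-1)\<^sup>l (2l+1) q\<^bsup>l(l+1)/2\<^esup>\<close> and
  \<open>\<theta> = q d/dq\<close>, the equation modulo \<open>e\<^sup>4\<close> is
  \<open>(w - 1) (J - e \<theta>J) + e\<^sup>2 \<theta>J / 3 - e\<^sup>3 \<theta>\<^sup>2J / 3 = 0\<close>. Jacobi's identity \<open>J = \<Prod>\<^sub>i (1 - q\<^sup>i)\<^sup>3\<close> gives
  \<open>\<theta>J = -3 u J\<close> for \<open>u = \<Sum>\<^sub>n \<sigma>(n) q\<^sup>n\<close>, and therefore \<open>w = 1 + e\<^sup>2 u - e\<^sup>3 \<theta>u + O(e\<^sup>4)\<close>, which determines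
  the two leading coefficients of the numerators.
\<close>

unbundle no vec_syntax

subsection \<open>The polynomials \<open>Q\<^sub>n\<close> and their degrees\<close>

lemma gam_eq_0: "n < l \<Longrightarrow> gam n l = 0"
proof -
  assume "n < l"
  hence "2 * n < l * (l + 1)"
    by (cases l) (auto intro!: order.strict_trans2[of "2*n" "2*l"] mult_le_mono)
  thus ?thesis by (simp add: gam_def)
qed

text \<open>Reversal turns the two top coefficients of \<open>Q n\<close> into a constant and a
  linear coefficient, which are easy to follow through a product of factors with constant term
  1.\<close>

lemma Q_reflect: "reflect_poly (Q n) = (\<Prod>l\<in>{1..n}. [:1, int l:] ^ gam n l)"
proof -
  have "reflect_poly (monom 1 n) = (1 :: int poly)"
    by (rule poly_eqI) (auto simp: coeff_reflect_poly degree_monom_eq)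
  thus ?thesis
    by (simp add: Q_def reflect_poly_mult reflect_poly_prod reflect_poly_power reflect_poly_pCons)
qed

lemma degree_Q: "degree (Q n) = M n"
proof -
  have "degree (\<Prod>l\<in>{1..n}. [:int l, 1:] ^ gam n l) = (\<Sum>l\<in>{1..n}. gam n l)"
    by (subst degree_prod_eq_sum_degree) (auto simp: degree_power_eq)
  thus ?thesis
    by (simp add: Q_def degree_mult_eq degree_monom_eq M_def mu_def prod_zero_iff)
qed

lemma Q_monic: "coeff (Q n) (M n) = 1"
proof -
  have "lead_coeff (Q n) = 1"
    by (simp add: Q_def lead_coeff_mult lead_coeff_prod lead_coeff_power degree_monom_eq)
  thus ?thesis by (simp add: degree_Q)
qed

lemma Q_second_coeff:
  assumes "n \<ge> 1"
  shows "coeff (Q n) (M n - 1) = int (mu 1 n)"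
proof -
  have pw: "coeff ([:1, x:] ^ m) 0 = 1 \<and> coeff ([:1, x:] ^ m) 1 = int m * x" for x :: int and m
    by (induction m) (auto simp: coeff_mult algebra_simps)
  have "coeff (\<Prod>l\<in>S. [:1, int l:] ^ gam n l) 0 = 1 \<and>
        coeff (\<Prod>l\<in>S. [:1, int l:] ^ gam n l) 1 = (\<Sum>l\<in>S. int (gam n l) * int l)"
    if "finite S" for S
    using that
    by induction (use pw in \<open>auto simp: coeff_mult algebra_simps\<close>)
  from this[of "{1..n}"] have "coeff (reflect_poly (Q n)) 1 = int (mu 1 n)"
    by (simp add: Q_reflect mu_def mult.commute)
  moreover have "M n \<ge> 1" using assms by (simp add: M_def)
  ultimately show ?thesis by (simp add: coeff_reflect_poly degree_Q)
qed

lemma poly_Q_pos: "k \<ge> 1 \<Longrightarrow> poly (Q n) (int k) > 0"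
  unfolding Q_def by (auto simp: poly_monom poly_prod intro!: mult_pos_pos prod_pos)

text \<open>Telescopes through 2/(l(l+1)) = 2/l - 2/(l+1). Together with the degree n of the factor
  x^n in \<open>Q n\<close>, the limit 2 accounts for the constant 3.\<close>

lemma sum_reciprocal_pronic: "(\<Sum>l\<in>{1..n}. 2 / (real l * (real l + 1))) = 2 - 2 / (real n + 1)"
proof (induction n)
  case (Suc n)
  have "2 - 2 / (real n + 1) + 2 / ((real n + 1) * (real n + 2)) = 2 - 2 / (real n + 2)"
    by (simp add: divide_simps) (simp add: algebra_simps)
  with Suc show ?case by (simp add: add.commute)
qed simp

lemma gam_le: "real (gam n l) \<le> real n * (2 / (real l * (real l + 1)))"
proof -
  have "real (2 * n div (l * (l + 1))) \<le> real (2 * n) / real (l * (l + 1))"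
    using of_int_floor_le[of "real (2 * n) / real (l * (l + 1))"]
    by (simp only: floor_divide_of_nat_eq of_int_of_nat_eq)
  thus ?thesis by (simp add: gam_def algebra_simps)
qed

lemma gam_ge: "real n * (2 / (real l * (real l + 1))) - 1 \<le> real (gam n l)"
proof -
  have "real (2 * n) / real (l * (l + 1)) - real (2 * n div (l * (l + 1))) \<le> 1"
    using real_of_int_floor_add_one_ge[of "real (2 * n) / real (l * (l + 1))"]
    by (simp only: floor_divide_of_nat_eq of_int_of_nat_eq)
  thus ?thesis by (simp add: gam_def algebra_simps)
qed

lemma M_le: "real (M n) \<le> 3 * real n - 2 * real n / (real n + 1)"
proof -
  have "real (M n) = real n + (\<Sum>l\<in>{1..n}. real (gam n l))"
    by (simp add: M_def mu_def)
  also have "\<dots> \<le> real n + (\<Sum>l\<in>{1..n}. real n * (2 / (real l * (real l + 1))))"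
    by (intro add_left_mono sum_mono gam_le)
  also have "\<dots> = real n + real n * (2 - 2 / (real n + 1))"
    by (simp only: sum_distrib_left[symmetric] sum_reciprocal_pronic)
  finally show ?thesis by (simp add: algebra_simps)
qed

lemma M_less: "n \<ge> 1 \<Longrightarrow> M n < 3 * n"
proof -
  assume "n \<ge> 1"
  hence "2 * real n / (real n + 1) > 0" by simp
  hence "real (M n) < real (3 * n)" using M_le[of n] by simp
  thus ?thesis by (simp only: of_nat_less_iff)
qed

text \<open>Cutting the sum at L loses 2n/(L+1), and each of the L floors kept loses at most 1.
  Choosing first L and then n large makes both losses small relative to n.\<close>

lemma M_ge:
  assumes "L \<le> n"
  shows "real (M n) \<ge> 3 * real n - 2 * real n / (real L + 1) - real L"
proof -
  have "real n + real n * (2 - 2 / (real L + 1)) - real L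
      = real n + (\<Sum>l\<in>{1..L}. real n * (2 / (real l * (real l + 1))) - 1)"
    by (simp only: sum_subtractf sum_distrib_left[symmetric] sum_reciprocal_pronic) simp
  also have "\<dots> \<le> real n + (\<Sum>l\<in>{1..L}. real (gam n l))"
    by (intro add_left_mono sum_mono gam_ge)
  also have "\<dots> \<le> real n + (\<Sum>l\<in>{1..n}. real (gam n l))"
    using assms by (intro add_left_mono sum_mono2) auto
  also have "\<dots> = real (M n)" by (simp add: M_def mu_def)
  finally show ?thesis by (simp add: algebra_simps)
qed

lemma M_over_n_tendsto: "(\<lambda>n. real (M n) / real n) \<longlonglongrightarrow> 3"
proof (rule LIMSEQ_I)
  fix \<epsilon> :: real assume e: "\<epsilon> > 0"
  obtain L :: nat where L: "2 / (real L + 1) < \<epsilon> / 2"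
  proof -
    obtain L :: nat where "4 / \<epsilon> < real L" using reals_Archimedean2 by blast
    hence "2 / (real L + 1) < \<epsilon> / 2" using e by (simp add: field_simps)
    thus ?thesis using that by blast
  qed
  obtain N :: nat where N: "2 * real L / \<epsilon> < real N" using reals_Archimedean2 by blast
  have "norm (real (M n) / real n - 3) < \<epsilon>" if n: "n \<ge> max 1 (max L N)" for n
  proof -
    have n': "real n > 0" "real n \<ge> real N" "L \<le> n" using n by auto
    have "2 * real L / \<epsilon> < real n" using N n' by linarith
    hence "real L / real n < \<epsilon> / 2" using e n' by (simp add: field_simps)
    moreover have "real (M n) / real n \<ge> (3 * real n - 2 * real n / (real L + 1) - real L) / real n"
      using M_ge[OF n'(3)] n' by (intro divide_right_mono) auto
    moreover have "(3 * real n - 2 * real n / (real L + 1) - real L) / real n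
        = 3 - 2 / (real L + 1) - real L / real n"
      using n' by (simp add: diff_divide_distrib)
    moreover have "real (M n) / real n < 3"
    proof -
      have "real (M n) < 3 * real n" using M_less[of n] n by simp
      thus ?thesis using n' by (simp add: field_simps)
    qed
    ultimately show ?thesis using L by simp
  qed
  thus "\<exists>no. \<forall>n\<ge>no. norm (real (M n) / real n - 3) < \<epsilon>" by blast
qed

lemma gam_1: "gam n 1 = n"
  by (simp add: gam_def flip: numeral_2_eq_2)

lemma M_ge_double: "n \<ge> 1 \<Longrightarrow> M n \<ge> 2 * n"
proof -
  assume "n \<ge> 1"
  hence "gam n 1 \<le> (\<Sum>l\<in>{1..n}. gam n l)" by (intro member_le_sum) auto
  thus ?thesis by (simp add: M_def mu_def gam_1[simplified])
qed

lemma mu_1_2: "mu 1 2 = 2"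
proof -
  have "{1..2::nat} = {1, 2}" by auto
  thus ?thesis by (simp add: mu_def gam_def flip: numeral_2_eq_2)
qed

text \<open>The index 1 alone contributes n, and the index 2 contributes as soon as 2n reaches
  6.\<close>

lemma mu_1_greater: "n \<ge> 3 \<Longrightarrow> mu 1 n > n"
proof -
  assume n: "n \<ge> 3"
  have "(\<Sum>l\<in>{1,2}. l ^ 1 * gam n l) \<le> mu 1 n"
    unfolding mu_def using n by (intro sum_mono2) auto
  moreover have "gam n 2 \<ge> 1" using n div_le_mono[of 6 "2 * n" 6] by (simp add: gam_def)
  ultimately show ?thesis using gam_1[of n] by simp
qed

lemma sigma_pos: "n \<ge> 1 \<Longrightarrow> sigma n > 0"
proof -
  assume n: "n \<ge> 1"
  hence "finite {d. d dvd n}" by (intro finite_divisors_nat) auto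
  hence "(1::nat) \<le> sigma n" unfolding sigma_def by (intro member_le_sum) auto
  thus ?thesis by simp
qed

section \<open>Numerators recovered from their asymptotics\<close>

lemma poly_over_power_degree_tendsto: "(\<lambda>k. real_of_int (poly p (int k)) / real k ^ degree p) \<longlonglongrightarrow> real_of_int (lead_coeff p)"
proof -
  define p' where "p' = map_poly real_of_int p"
  have deg: "degree p' = degree p" by (simp add: p'_def degree_map_poly)
  have ev: "real_of_int (poly p (int k)) = poly p' (real k)" for k
    by (simp add: poly_altdef deg) (simp add: p'_def coeff_map_poly)
  have "((\<lambda>x. poly p' x / x ^ degree p') \<longlongrightarrow> lead_coeff p') at_infinity"
    by (rule poly_divide_tendsto_aux)
  hence "(\<lambda>k. poly p' (real k) / real k ^ degree p') \<longlonglongrightarrow> lead_coeff p'"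
    by (rule filterlim_compose) (rule tendsto_of_nat)
  thus ?thesis by (simp add: ev deg) (simp add: p'_def coeff_map_poly)
qed

text \<open>With a larger degree, p(k) / k^(deg p) would tend both to 0 and to the leading
  coefficient.\<close>

lemma degree_le_of_bigo:
  fixes p :: "int poly"
  assumes "(\<lambda>k. real_of_int (poly p (int k))) \<in> O(\<lambda>k. real k ^ d)"
  shows "degree p \<le> d"
proof (rule ccontr)
  assume "\<not> degree p \<le> d"
  hence deg: "d < degree p" by simp
  have pos: "eventually (\<lambda>k::nat. k > 0) sequentially" by (rule eventually_gt_at_top)
  have "(\<lambda>k. real_of_int (poly p (int k)) / real k ^ degree p) \<in> O(\<lambda>k. real k ^ d / real k ^ degree p)"
    using assms by (intro landau_o.big.divide_right) (use pos in \<open>auto elim: eventually_mono\<close>)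
  also have "(\<lambda>k. real k ^ d / real k ^ degree p) \<in> O(\<lambda>k. inverse (real k))"
  proof (rule bigoI[of _ 1], use pos in eventually_elim)
    case (elim k)
    have "real k ^ Suc d \<le> real k ^ degree p"
      using deg elim by (intro power_increasing) auto
    thus ?case using elim by (simp add: field_simps)
  qed
  also have "(\<lambda>k. inverse (real k)) \<in> o(\<lambda>k. 1)"
    by (intro smalloI_tendsto) (auto intro: lim_inverse_n)
  finally have "(\<lambda>k. real_of_int (poly p (int k)) / real k ^ degree p) \<longlonglongrightarrow> 0"
    by (auto dest: smalloD_tendsto)
  hence "real_of_int (lead_coeff p) = 0" using poly_over_power_degree_tendsto LIMSEQ_unique by blast
  thus False using deg by auto
qed

text \<open>The difference \<open>X\<^sup>3 p - s (X - n) Q\<^sub>n\<close> is \<open>O(Q\<^sub>n(k) / k)\<close> on the integers, so its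
  degree is below \<open>M\<^sub>n\<close>.\<close>

lemma numerator_coeffs:
  fixes p :: "int poly" and s :: int
  assumes n: "n \<ge> 2" and s: "s \<noteq> 0"
    and asy: "(\<lambda>k. real_of_int (poly p (int k)) / real_of_int (poly (Q n) (int k))
                - of_int s * (1 / real k ^ 2 - real n / real k ^ 3)) \<in> O(\<lambda>k. 1 / real k ^ 4)"
  shows "degree p = M n - 2" "coeff p (M n - 2) = s" "coeff p (M n - 3) = s * (int (mu 1 n) - int n)"
proof -
  \<comment> \<open>Guarantees that the subtractions in \<open>M n - 2\<close> and
    \<open>M n - 3\<close> are not truncated.\<close>
  have M4: "M n \<ge> 4" using M_ge_double[of n] n by simp
  define D where "D = monom 1 3 * p - [: - s * int n, s:] * Q n"
  have pos: "eventually (\<lambda>k::nat. k > 0) sequentially" by (rule eventually_gt_at_top)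
  let ?E = "\<lambda>k. real_of_int (poly p (int k)) / real_of_int (poly (Q n) (int k))
                - of_int s * (1 / real k ^ 2 - real n / real k ^ 3)"
  have "(\<lambda>k. real_of_int (poly (Q n) (int k)) / real k ^ M n) \<in> O(\<lambda>k. 1)"
    using poly_over_power_degree_tendsto[of "Q n"] by (intro bigoI_tendsto[where c = "of_int (lead_coeff (Q n))"]) (auto simp: degree_Q)
  hence "(\<lambda>k. real_of_int (poly (Q n) (int k)) / real k ^ M n * (real k ^ M n)) \<in> O(\<lambda>k. 1 * (real k ^ M n))"
    by (rule landau_o.big.mult_right)
  also have "?this \<longleftrightarrow> (\<lambda>k. real_of_int (poly (Q n) (int k))) \<in> O(\<lambda>k. real k ^ M n)"
    by (intro landau_o.big.cong_ex eventually_mono[OF pos]) auto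
  finally have QO: "(\<lambda>k. real_of_int (poly (Q n) (int k))) \<in> O(\<lambda>k. real k ^ M n)" .
  have "(\<lambda>k. real_of_int (poly D (int k))) \<in> O(\<lambda>k. real k ^ (M n - 1))"
  proof -
    have "(\<lambda>k. ?E k * real_of_int (poly (Q n) (int k)) * real k ^ 3)
            \<in> O(\<lambda>k. 1 / real k ^ 4 * real k ^ M n * real k ^ 3)"
      by (intro landau_o.big.mult asy QO) auto
    also have "?this \<longleftrightarrow> (\<lambda>k. real_of_int (poly D (int k))) \<in> O(\<lambda>k. real k ^ (M n - 1))"
    proof (intro landau_o.big.cong_ex eventually_mono[OF pos])
      fix k :: nat assume k: "k > 0"
      hence "real_of_int (poly (Q n) (int k)) \<noteq> 0" using poly_Q_pos[of k n] by simp
      thus "?E k * real_of_int (poly (Q n) (int k)) * real k ^ 3 = real_of_int (poly D (int k))"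
        using k by (simp add: D_def poly_monom field_simps power2_eq_square power3_eq_cube)
      obtain m where "M n = Suc m" using M4 by (cases "M n") auto
      thus "1 / real k ^ 4 * real k ^ M n * real k ^ 3 = real k ^ (M n - 1)"
        using k by (simp add: field_simps power4_eq_xxxx power3_eq_cube)
    qed
    finally show ?thesis .
  qed
  hence "degree D \<le> M n - 1" by (rule degree_le_of_bigo)
  hence D0: "coeff D i = 0" if "i \<ge> M n" for i
    using that M4 by (intro coeff_eq_0) auto
  have cD: "coeff D i = coeff p (i - 3) - (s * coeff (Q n) (i - 1) - s * int n * coeff (Q n) i)"
    if "i \<ge> 3" for i
    using that by (cases i) (auto simp: D_def coeff_monom_mult)
  have Q0: "coeff (Q n) i = 0" if "i > M n" for i
    using that by (intro coeff_eq_0) (auto simp: degree_Q)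
  \<comment> \<open>The coefficients of \<open>D\<close> vanish from index \<open>M n\<close> on.
    Index \<open>M n + 1\<close> gives the leading coefficient of \<open>p\<close>, index
    \<open>M n\<close> the next one.\<close>
  show c2: "coeff p (M n - 2) = s"
    using D0[of "M n + 1"] cD[of "M n + 1"] M4 Q0[of "M n + 1"] Q_monic[of n]
    by (simp add: numeral_eq_Suc)
  show "coeff p (M n - 3) = s * (int (mu 1 n) - int n)"
    using D0[of "M n"] cD[of "M n"] M4 Q_monic[of n] Q_second_coeff[of n] n
    by (simp add: algebra_simps)
  have "coeff p i = 0" if "i > M n - 2" for i
    using D0[of "i + 3"] cD[of "i + 3"] that M4 Q0[of "i + 3"] Q0[of "i + 2"]
    by (simp add: numeral_eq_Suc)
  hence "degree p \<le> M n - 2" by (intro degree_le) auto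
  thus "degree p = M n - 2" using le_degree[of p "M n - 2"] c2 s by simp
qed

subsection \<open>Jacobi's identity for the cube of the Euler product\<close>

definition tri :: "nat \<Rightarrow> nat" where
  "tri l = l * (l + 1) div 2"

lemma tri_0 [simp]: "tri 0 = 0"
  by (simp add: tri_def)

lemma tri_Suc: "tri (Suc l) = tri l + Suc l"
  by (simp add: tri_def)

lemma le_tri: "l \<le> tri l"
  by (induction l) (auto simp: tri_Suc)

lemma real_tri: "real (tri l) = real l * (real l + 1) / 2"
  by (induction l) (auto simp: tri_Suc field_simps)

definition qpoch :: "nat \<Rightarrow> real fps" where
  "qpoch n = (\<Prod>i\<in>{1..n}. 1 - fps_X ^ i)"

lemma qpoch_0 [simp]: "qpoch 0 = 1"
  by (simp add: qpoch_def)

lemma qpoch_Suc: "qpoch (Suc n) = qpoch n * (1 - fps_X ^ Suc n)"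
  by (simp add: qpoch_def)

lemma qpoch_nth_0 [simp]: "qpoch n $ 0 = 1"
  by (induction n) (auto simp: qpoch_Suc)

text \<open>The coefficient of \<open>z\<^sup>j\<close> in \<open>(1 - 1/z) \<Prod>\<^sub>i\<^sub>\<le>\<^sub>N (1 - z q\<^sup>i) (1 - q\<^sup>i / z)\<close>. The coefficient of
  \<open>z\<^bsup>-1-j\<^esup>\<close> is its negative, so only \<open>j \<ge> 0\<close> is needed; this explains the term \<open>- jacobi_coeff N 0\<close> in the
  recurrence at 0 below.\<close>

definition jacobi_coeff :: "nat \<Rightarrow> nat \<Rightarrow> real fps" where
  "jacobi_coeff N j = (if j \<le> N then (-1) ^ j * fps_X ^ tri j * qpoch (2 * N + 1) *
      inverse (qpoch (N - j)) * inverse (qpoch (N + 1 + j)) else 0)"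

text \<open>The argument is shifted by one, so that \<open>inv_qpoch 0 = 0\<close> plays the role of \<open>1 / (q)\<^sub>-\<^sub>1\<close>.\<close>

definition inv_qpoch :: "nat \<Rightarrow> real fps" where
  "inv_qpoch s = (case s of 0 \<Rightarrow> 0 | Suc n \<Rightarrow> inverse (qpoch n))"

lemma inv_qpoch_step: "inv_qpoch s = (1 - fps_X ^ s) * inv_qpoch (Suc s)"
proof (cases s)
  case (Suc n)
  have "inverse (qpoch (Suc n)) = inverse (qpoch n) * inverse (1 - fps_X ^ Suc n)"
    by (simp add: qpoch_Suc fps_inverse_mult)
  moreover have "inverse (1 - fps_X ^ Suc n) * (1 - fps_X ^ Suc n :: real fps) = 1"
    by (intro inverse_mult_eq_1) auto
  ultimately show ?thesis using Suc by (simp add: inv_qpoch_def mult_ac)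
qed (simp add: inv_qpoch_def)

lemma jacobi_coeff_inv_qpoch: "j \<le> N + 1 \<Longrightarrow> jacobi_coeff N j = (-1) ^ j * fps_X ^ tri j * qpoch (2 * N + 1) *
      inv_qpoch (N + 1 - j) * inv_qpoch (N + 2 + j)"
  by (cases "j \<le> N") (auto simp: jacobi_coeff_def inv_qpoch_def Suc_diff_le le_Suc_eq)

text \<open>The recurrences below with common factors removed: x = q^(N-1-j), y = q^(N+j+2), so that
  x y q = q^(2N+2), while S and R are the shared reciprocals of q-factorials. The recurrence at 0 is
  the instance j = -1.\<close>

lemma jacobi_coeff_rec_aux:
  fixes x y q P S R :: "'a :: comm_ring_1"
  shows "P * (1 - x * y * q) * (1 - x * y * q ^ 2) * S * R =
     (1 + x * y * q) * P * ((1 - x * q) * S) * ((1 - y * q) * R)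
     + q * x * P * S * ((1 - y) * ((1 - y * q) * R))
     + q * y * P * ((1 - x) * ((1 - x * q) * S)) * R"
  by (simp add: algebra_simps power2_eq_square)

lemma qpoch_double_Suc:
  "qpoch (2 * Suc N + 1) = qpoch (2 * N + 1) * (1 - fps_X ^ (2 * N + 2)) * (1 - fps_X ^ (2 * N + 2) * fps_X)"
  using qpoch_Suc[of "2 * N + 2"] qpoch_Suc[of "2 * N + 1"] by (simp add: mult_ac)

text \<open>Passing from N to N+1 multiplies the generating product by (1 - z q^(N+1)) (1 -
  q^(N+1)/z) = 1 + q^(2N+2) - q^(N+1) (z + 1/z). Comparing coefficients of z^j gives this recurrence
  and the next one.\<close>

lemma jacobi_coeff_rec_0:
  "jacobi_coeff (Suc N) 0 = (1 + fps_X ^ (2 * Suc N)) * jacobi_coeff N 0 - fps_X ^ Suc N * (- jacobi_coeff N 0 + jacobi_coeff N 1)"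
proof -
  define x :: "real fps" where "x = fps_X ^ N"
  define S where "S = inv_qpoch (N + 2)"
  define R where "R = inv_qpoch (N + 3)"
  have R1: "S = (1 - x * fps_X ^ 2) * R"
    using inv_qpoch_step[of "N + 2"] by (simp only: S_def R_def x_def power_add add_Suc_right[symmetric] Suc_numeral) simp
  have S1: "inv_qpoch (N + 1) = (1 - x * fps_X) * S"
    unfolding S_def x_def by (subst inv_qpoch_step) (simp add: mult.commute)
  have S0: "inv_qpoch N = (1 - x) * ((1 - x * fps_X) * S)"
    by (subst inv_qpoch_step) (use S1 in \<open>simp add: x_def\<close>)
  have X: "fps_X ^ (2 * N + 2) = x * (x * fps_X) * fps_X"
  proof -
    have "2 * N + 2 = N + N + 1 + 1" by simp
    thus ?thesis by (simp only: x_def power_add power_one_right mult.assoc)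
  qed
  have "jacobi_coeff (Suc N) 0 = qpoch (2 * N + 1) * (1 - x * (x * fps_X) * fps_X) *
          (1 - x * (x * fps_X) * fps_X ^ 2) * S * R"
  proof -
    have "jacobi_coeff (Suc N) 0 = qpoch (2 * Suc N + 1) * S * R"
      by (subst jacobi_coeff_inv_qpoch) (simp_all add: S_def R_def numeral_3_eq_3)
    thus ?thesis by (simp only: qpoch_double_Suc X power2_eq_square mult.assoc)
  qed
  moreover have "jacobi_coeff N 0 = qpoch (2 * N + 1) * ((1 - x * fps_X) * S) * ((1 - x * fps_X * fps_X) * R)"
    by (subst jacobi_coeff_inv_qpoch) (use S1 R1 in \<open>simp_all add: S_def power2_eq_square mult_ac\<close>)
  \<comment> \<open>The same coefficient in a second shape: here it stands, up to sign, for the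
    coefficient of 1/z.\<close>
  moreover have "jacobi_coeff N 0 = qpoch (2 * N + 1) * S * ((1 - x * fps_X) * ((1 - x * fps_X * fps_X) * R))"
    by (subst jacobi_coeff_inv_qpoch) (use S1 R1 in \<open>simp_all add: S_def power2_eq_square mult_ac\<close>)
  moreover have "jacobi_coeff N 1 = - fps_X * qpoch (2 * N + 1) * ((1 - x) * ((1 - x * fps_X) * S)) * R"
    by (subst jacobi_coeff_inv_qpoch) (use S0 in \<open>simp_all add: R_def tri_def numeral_3_eq_3\<close>)
  moreover have "fps_X ^ (2 * Suc N) = x * (x * fps_X) * fps_X"
    using X by simp
  moreover have "fps_X ^ Suc N = fps_X * x"
    by (simp add: x_def)
  ultimately show ?thesis
    using jacobi_coeff_rec_aux[of "qpoch (2 * N + 1)" x "x * fps_X" fps_X S R]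
    by (simp only:) (simp add: algebra_simps)
qed

lemma jacobi_coeff_rec_Suc:
  "jacobi_coeff (Suc N) (Suc j) = (1 + fps_X ^ (2 * Suc N)) * jacobi_coeff N (Suc j)
      - fps_X ^ Suc N * (jacobi_coeff N j + jacobi_coeff N (Suc (Suc j)))"
proof -
  consider "j < N" | "j = N" | "j > N" by linarith
  thus ?thesis
  proof cases
    case 1
    then obtain d where N: "N = Suc (j + d)" by (auto simp: less_iff_Suc_add)
    define x :: "real fps" where "x = fps_X ^ d"
    define y :: "real fps" where "y = fps_X ^ (N + j + 2)"
    define C :: "real fps" where "C = (-1) ^ Suc j * fps_X ^ tri (Suc j)"
    define S where "S = inv_qpoch (d + 2)"
    define R where "R = inv_qpoch (N + 4 + j)"
    have S1: "inv_qpoch (d + 1) = (1 - x * fps_X) * S"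
      unfolding S_def x_def by (subst inv_qpoch_step) (simp add: mult.commute)
    have S0: "inv_qpoch d = (1 - x) * ((1 - x * fps_X) * S)"
      by (subst inv_qpoch_step) (use S1 in \<open>simp add: x_def\<close>)
    have R1: "inv_qpoch (N + 3 + j) = (1 - y * fps_X) * R"
      unfolding R_def y_def by (subst inv_qpoch_step) (simp add: algebra_simps numeral_eq_Suc)
    have R0: "inv_qpoch (N + 2 + j) = (1 - y) * ((1 - y * fps_X) * R)"
    proof -
      have "Suc (N + 2 + j) = N + 3 + j" "N + 2 + j = N + j + 2" by simp_all
      thus ?thesis using inv_qpoch_step[of "N + 2 + j"] by (simp only: R1 y_def)
    qed
    have X: "fps_X ^ (2 * N + 2) = x * y * fps_X"
    proof -
      have "2 * N + 2 = d + (N + j + 2) + 1" using N by simp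
      thus ?thesis unfolding x_def y_def by (simp only: power_add power_one_right)
    qed
    have a1: "jacobi_coeff (Suc N) (Suc j) = C * (qpoch (2 * N + 1) * (1 - x * y * fps_X) *
          (1 - x * y * fps_X ^ 2) * S * R)"
    proof -
      have "Suc N + 1 - Suc j = d + 2" "Suc N + 2 + Suc j = N + 4 + j" using N by auto
      hence "jacobi_coeff (Suc N) (Suc j) = C * qpoch (2 * Suc N + 1) * S * R"
        using N by (subst jacobi_coeff_inv_qpoch) (simp, simp only: S_def R_def C_def)
      thus ?thesis
        by (simp only: qpoch_double_Suc X power2_eq_square mult.assoc)
    qed
    have a2: "jacobi_coeff N (Suc j) = C * (qpoch (2 * N + 1) * ((1 - x * fps_X) * S) * ((1 - y * fps_X) * R))"
    proof -
      have "N + 1 - Suc j = d + 1" "N + 2 + Suc j = N + 3 + j" using N by auto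
      thus ?thesis
        by (subst jacobi_coeff_inv_qpoch) (use N in simp, simp only: S1 R1 C_def, simp only: mult_ac)
    qed
    have a3: "fps_X ^ Suc N * jacobi_coeff N j = - (C * (fps_X * x * qpoch (2 * N + 1) * S * ((1 - y) * ((1 - y * fps_X) * R))))"
    proof -
      have e: "N + 1 - j = d + 2" using N by auto
      have "fps_X ^ Suc N * ((-1) ^ j * fps_X ^ tri j) = - (C * (fps_X * x))"
        by (simp add: C_def x_def N tri_Suc power_add mult_ac)
      hence "fps_X ^ Suc N * ((-1) ^ j * fps_X ^ tri j) * qpoch (2 * N + 1) * S * inv_qpoch (N + 2 + j)
         = - (C * (fps_X * x)) * qpoch (2 * N + 1) * S * inv_qpoch (N + 2 + j)" by simp
      thus ?thesis
        by (subst jacobi_coeff_inv_qpoch) (use N in simp, simp only: e S_def[symmetric] R0, simp add: mult_ac)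
    qed
    have a4: "fps_X ^ Suc N * jacobi_coeff N (Suc (Suc j)) = - (C * (fps_X * y * qpoch (2 * N + 1) * ((1 - x) * ((1 - x * fps_X) * S)) * R))"
    proof -
      have e: "N + 1 - Suc (Suc j) = d" "N + 2 + Suc (Suc j) = N + 4 + j" using N by auto
      have "fps_X ^ Suc N * ((-1) ^ Suc (Suc j) * fps_X ^ tri (Suc (Suc j))) = - (C * (fps_X * y))"
        by (simp add: C_def y_def N tri_Suc power_add mult_ac)
      hence "fps_X ^ Suc N * ((-1) ^ Suc (Suc j) * fps_X ^ tri (Suc (Suc j))) * qpoch (2 * N + 1) * inv_qpoch d * R
         = - (C * (fps_X * y)) * qpoch (2 * N + 1) * inv_qpoch d * R" by simp
      thus ?thesis
        by (subst jacobi_coeff_inv_qpoch) (use N in simp, simp only: e R_def[symmetric] S0, simp add: mult_ac)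
    qed
    have a5: "fps_X ^ (2 * Suc N) = x * y * fps_X" using X by simp
    show ?thesis
      unfolding distrib_left[of "fps_X ^ Suc N"] a1 a2 a3 a4 a5 jacobi_coeff_rec_aux
      by (simp add: algebra_simps)
  next
    \<comment> \<open>At the edge \<open>j = N\<close> the coefficients of index N+1 and N+2 on the
      right vanish and only the one of index N survives.\<close>
    case 2
    have "inv_qpoch (2 * N + 2) = (1 - fps_X ^ (2 * N + 2)) * ((1 - fps_X ^ (2 * N + 2) * fps_X) * inv_qpoch (2 * N + 4))"
      by (subst inv_qpoch_step, subst inv_qpoch_step) (simp add: numeral_eq_Suc mult_ac)
    moreover have "jacobi_coeff (Suc N) (Suc N) = (-1) ^ Suc N * fps_X ^ tri (Suc N) * qpoch (2 * Suc N + 1) * inv_qpoch 1 * inv_qpoch (2 * N + 4)"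
      by (subst jacobi_coeff_inv_qpoch) (auto simp: mult_2 numeral_eq_Suc)
    moreover have "jacobi_coeff N N = (-1) ^ N * fps_X ^ tri N * qpoch (2 * N + 1) * inv_qpoch 1 * inv_qpoch (2 * N + 2)"
      by (subst jacobi_coeff_inv_qpoch) (auto simp: mult_2)
    moreover have "jacobi_coeff N (Suc N) = 0" "jacobi_coeff N (Suc (Suc N)) = 0" by (auto simp: jacobi_coeff_def)
    ultimately show ?thesis using 2
      by (simp only: qpoch_double_Suc) (simp add: tri_Suc power_add mult_ac)
  next
    case 3
    thus ?thesis by (simp add: jacobi_coeff_def)
  qed
qed

text \<open>Pairing j with -1-j under c(-1-j) = -c(j), the weighted sum is the derivative at z = 1
  of the generating function, which vanishes there. Hence the factor u - v (z + 1/z) enters only by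
  its value u - 2v; the last summand is the boundary term of the cut at K.\<close>

lemma antisymmetric_weighted_sum:
  fixes b c :: "nat \<Rightarrow> 'a :: comm_ring_1"
  assumes "b 0 = u * c 0 - v * (- c 0 + c 1)"
    and "\<And>j. b (Suc j) = u * c (Suc j) - v * (c j + c (Suc (Suc j)))"
  shows "(\<Sum>j\<le>K. of_nat (2 * j + 1) * b j) = (u - 2 * v) * (\<Sum>j\<le>K. of_nat (2 * j + 1) * c j)
           + v * (of_nat (2 * K + 3) * c K - of_nat (2 * K + 1) * c (Suc K))"
  by (induction K) (simp_all add: assms algebra_simps)

text \<open>Both sides are the derivative at z = 1 of the generating product: its factor 1 - 1/z
  vanishes there with derivative 1, and the remaining factors give the square.\<close>

lemma jacobi_coeff_weighted_sum: "K \<ge> N \<Longrightarrow> (\<Sum>j\<le>K. of_nat (2 * j + 1) * jacobi_coeff N j) = qpoch N ^ 2"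
proof (induction N arbitrary: K)
  case 0
  have "(\<Sum>j\<le>K. of_nat (2 * j + 1) * jacobi_coeff 0 j) = (\<Sum>j\<in>{0}. of_nat (2 * j + 1) * jacobi_coeff 0 j)"
    by (intro sum.mono_neutral_right) (auto simp: jacobi_coeff_def)
  also have "\<dots> = 1"
    using inverse_mult_eq_1'[of "qpoch 1"] by (simp add: jacobi_coeff_def)
  finally show ?case by simp
next
  case (Suc N)
  have "jacobi_coeff N K = 0" "jacobi_coeff N (Suc K) = 0" using Suc.prems by (auto simp: jacobi_coeff_def)
  hence "(\<Sum>j\<le>K. of_nat (2 * j + 1) * jacobi_coeff (Suc N) j) =
      (1 + fps_X ^ (2 * Suc N) - 2 * fps_X ^ Suc N) * (\<Sum>j\<le>K. of_nat (2 * j + 1) * jacobi_coeff N j)"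
    by (subst antisymmetric_weighted_sum[OF jacobi_coeff_rec_0 jacobi_coeff_rec_Suc]) simp
  also have "(\<Sum>j\<le>K. of_nat (2 * j + 1) * jacobi_coeff N j) = qpoch N ^ 2"
    using Suc by simp
  also have "1 + fps_X ^ (2 * Suc N) - 2 * fps_X ^ Suc N = (1 - fps_X ^ Suc N :: real fps) ^ 2"
    by (simp only: power2_diff power_even_eq) simp
  finally show ?case by (simp only: qpoch_Suc power_mult_distrib mult.commute)
qed

lemma fps_X_power_dvd_iff: "fps_X ^ n dvd (f :: 'a :: comm_ring_1 fps) \<longleftrightarrow> (\<forall>m<n. f $ m = 0)"
proof
  assume "fps_X ^ n dvd f"
  thus "\<forall>m<n. f $ m = 0" by (auto simp: dvd_def fps_X_power_mult_nth)
next
  assume "\<forall>m<n. f $ m = 0"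
  hence "f = fps_X ^ n * fps_shift n f"
    by (intro fps_ext) (auto simp: fps_X_power_mult_nth)
  thus "fps_X ^ n dvd f" by (rule dvdI)
qed

lemma qpoch_dvd_diff: "m \<le> n \<Longrightarrow> fps_X ^ Suc m dvd qpoch n - qpoch m"
proof (induction n rule: dec_induct)
  case (step n)
  have "qpoch (Suc n) - qpoch m = (qpoch n - qpoch m) - fps_X ^ Suc n * qpoch n"
    by (simp add: qpoch_Suc algebra_simps)
  moreover have "fps_X ^ Suc m dvd fps_X ^ Suc n * qpoch n"
    using step by (intro dvd_mult2 le_imp_power_dvd) auto
  ultimately show ?case using step.IH by (simp only: dvd_diff)
qed simp

definition theta_fps :: "nat \<Rightarrow> real fps" where
  "theta_fps N = (\<Sum>j\<le>N. of_nat (2 * j + 1) * ((-1) ^ j * fps_X ^ tri j))"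

text \<open>Multiplying the previous identity by one more \<open>qpoch N\<close> makes the quotients
  of q-factorials in the j-th summand equal to 1 modulo q^(N-j+1). The factor q^(tri j) supplies the
  missing powers because tri j is at least j.\<close>

lemma jacobi_cube: "fps_X ^ Suc N dvd qpoch N ^ 3 - theta_fps N"
proof -
  have *: "fps_X ^ Suc N dvd jacobi_coeff N j * qpoch N - (-1) ^ j * fps_X ^ tri j" if j: "j \<le> N" for j
  proof -
    define s where "s = qpoch N * inverse (qpoch (N - j))"
    define t where "t = qpoch (2 * N + 1) * inverse (qpoch (N + 1 + j))"
    have inv: "qpoch i * inverse (qpoch i) = 1" for i
      by (simp add: inverse_mult_eq_1')
    have "s - 1 = (qpoch N - qpoch (N - j)) * inverse (qpoch (N - j))"
      by (simp add: s_def left_diff_distrib inv)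
    hence s: "fps_X ^ Suc (N - j) dvd s - 1"
      by (simp only:) (intro dvd_mult2 qpoch_dvd_diff, simp)
    have "t - 1 = (qpoch (2 * N + 1) - qpoch (N + 1 + j)) * inverse (qpoch (N + 1 + j))"
      by (simp only: t_def left_diff_distrib inv)
    hence "fps_X ^ Suc (N + 1 + j) dvd t - 1"
      by (simp only:) (intro dvd_mult2 qpoch_dvd_diff, use j in simp)
    hence t: "fps_X ^ Suc (N - j) dvd t - 1"
      by (rule dvd_trans[rotated]) (intro le_imp_power_dvd, simp)
    have "fps_X ^ Suc (N - j) dvd (s - 1) * t + (t - 1)"
      using s t by (intro dvd_add dvd_mult2)
    hence "fps_X ^ tri j * fps_X ^ Suc (N - j) dvd fps_X ^ tri j * (s * t - 1)"
      by (intro mult_dvd_mono) (auto simp: algebra_simps)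
    moreover have "fps_X ^ Suc N dvd (fps_X ^ tri j * fps_X ^ Suc (N - j) :: real fps)"
      unfolding power_add[symmetric] using j le_tri[of j] by (intro le_imp_power_dvd) auto
    ultimately have "fps_X ^ Suc N dvd fps_X ^ tri j * (s * t - 1)" by (rule dvd_trans[rotated])
    hence "fps_X ^ Suc N dvd (-1) ^ j * (fps_X ^ tri j * (s * t - 1))" by (rule dvd_mult)
    also have "(-1) ^ j * (fps_X ^ tri j * (s * t - 1)) = jacobi_coeff N j * qpoch N - (-1) ^ j * fps_X ^ tri j"
      using j by (simp add: jacobi_coeff_def s_def t_def algebra_simps)
    finally show ?thesis .
  qed
  have "qpoch N ^ 3 - theta_fps N = (\<Sum>j\<le>N. of_nat (2 * j + 1) * jacobi_coeff N j) * qpoch N - theta_fps N"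
    by (simp only: jacobi_coeff_weighted_sum[OF order.refl] power2_eq_square power3_eq_cube)
  also have "\<dots> = (\<Sum>j\<le>N. of_nat (2 * j + 1) * (jacobi_coeff N j * qpoch N - (-1) ^ j * fps_X ^ tri j))"
    by (simp only: theta_fps_def sum_distrib_right sum_subtractf[symmetric])
       (simp only: right_diff_distrib mult.assoc)
  also have "fps_X ^ Suc N dvd \<dots>"
    by (intro dvd_sum dvd_mult *) auto
  finally show ?thesis .
qed

section \<open>The operator q d/dq, logarithmic derivatives and divisor sums\<close>

definition euler :: "real fps \<Rightarrow> real fps" where
  "euler f = fps_X * fps_deriv f"

lemma euler_nth: "euler f $ n = of_nat n * f $ n"
  by (cases n) (auto simp: euler_def)

lemma euler_add: "euler (f + g) = euler f + euler g"
  by (simp add: euler_def algebra_simps)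

lemma euler_diff: "euler (f - g) = euler f - euler g"
  by (simp add: euler_def algebra_simps)

lemma euler_mult: "euler (f * g) = euler f * g + f * euler g"
  by (simp add: euler_def algebra_simps)

lemma euler_dvd: "fps_X ^ n dvd f \<Longrightarrow> fps_X ^ n dvd euler f"
  by (simp add: fps_X_power_dvd_iff euler_nth)

definition sigma_fps :: "real fps" where
  "sigma_fps = Abs_fps (\<lambda>n. if n = 0 then 0 else of_nat (sigma n))"

text \<open>Logarithmic differentiation: the factor 1 - q^i contributes -i q^i / (1 - q^i), whose
  coefficient at q^n is -i if i divides n. Divisors of m at most N are all reached by the N factors,
  so the Lambert series agrees with \<open>sigma_fps\<close> up to q^N.\<close>

lemma euler_qpoch: "fps_X ^ Suc N dvd euler (qpoch N) + sigma_fps * qpoch N"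
proof -
  define g :: "nat \<Rightarrow> real fps" where
    "g i = Abs_fps (\<lambda>n. if n > 0 \<and> i dvd n then of_nat i else 0)" for i
  have g: "g i * (1 - fps_X ^ i) = of_nat i * fps_X ^ i" if "i > 0" for i
  proof (rule fps_ext)
    fix n
    have "(g i * (1 - fps_X ^ i)) $ n = g i $ n - (if n < i then 0 else g i $ (n - i))"
      by (simp add: right_diff_distrib fps_X_power_mult_right_nth)
    also have "\<dots> = (of_nat i * fps_X ^ i) $ n"
    proof -
      consider "n < i" | "n = i" | "n > i" by linarith
      thus ?thesis
      proof cases
        case 3
        hence "i dvd n - i \<longleftrightarrow> i dvd n" by (metis dvd_diff_nat dvd_diffD dvd_refl less_imp_le)
        thus ?thesis using 3 that by (simp add: g_def fps_of_nat[symmetric] del: fps_of_nat)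
      qed (use that in \<open>auto simp: g_def fps_of_nat[symmetric] dest: dvd_imp_le simp del: fps_of_nat\<close>)
    qed
    finally show "(g i * (1 - fps_X ^ i)) $ n = (of_nat i * fps_X ^ i) $ n" .
  qed
  have eX: "euler (1 - fps_X ^ i) = - of_nat i * fps_X ^ i" for i
    by (rule fps_ext) (auto simp: euler_nth fps_of_nat[symmetric] simp del: fps_of_nat)
  have "euler (qpoch n) = - (\<Sum>i\<in>{1..n}. g i) * qpoch n" for n
  proof (induction n)
    case 0
    show ?case by (rule fps_ext) (simp add: euler_nth)
  next
    case (Suc n)
    have "euler (qpoch (Suc n)) = euler (qpoch n) * (1 - fps_X ^ Suc n) - qpoch n * (of_nat (Suc n) * fps_X ^ Suc n)"
      unfolding qpoch_Suc euler_mult eX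
      by (simp only: minus_mult_left[symmetric] minus_mult_right[symmetric] diff_conv_add_uminus)
    also have "\<dots> = - (\<Sum>i\<in>{1..n}. g i) * qpoch n * (1 - fps_X ^ Suc n) - qpoch n * (g (Suc n) * (1 - fps_X ^ Suc n))"
      by (simp only: Suc.IH g zero_less_Suc)
    also have "\<dots> = - (\<Sum>i\<in>{1..Suc n}. g i) * qpoch (Suc n)"
      by (simp only: qpoch_Suc) (simp add: algebra_simps)
    finally show ?case .
  qed
  hence "euler (qpoch N) + sigma_fps * qpoch N = (sigma_fps - (\<Sum>i\<in>{1..N}. g i)) * qpoch N"
    by (simp add: algebra_simps)
  moreover have "fps_X ^ Suc N dvd sigma_fps - (\<Sum>i\<in>{1..N}. g i)"
    unfolding fps_X_power_dvd_iff
  proof (intro allI impI)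
    fix m assume m: "m < Suc N"
    have "(\<Sum>i\<in>{1..N}. g i) $ m = (\<Sum>i\<in>{1..N}. if m > 0 \<and> i dvd m then real i else 0)"
      by (simp add: fps_sum_nth g_def)
    also have "\<dots> = sigma_fps $ m"
    proof (cases "m = 0")
      case False
      have "(\<Sum>i\<in>{1..N}. if m > 0 \<and> i dvd m then real i else 0) = (\<Sum>i\<in>{d. d dvd m}. real i)"
      proof (intro sum.mono_neutral_cong_right subsetI)
        fix d assume "d \<in> {d. d dvd m}"
        thus "d \<in> {1..N}" using False m dvd_imp_le[of d m] dvd_pos_nat[of m d] by simp
      qed (use False in auto)
      thus ?thesis using False by (simp add: sigma_fps_def sigma_def)
    qed (simp add: sigma_fps_def)
    finally show "(sigma_fps - (\<Sum>i\<in>{1..N}. g i)) $ m = 0" by simp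
  qed
  ultimately show ?thesis by (simp only: dvd_mult2)
qed

text \<open>The logarithmic derivative of a cube is three times that of its base; the error of the
  truncated Jacobi identity stays divisible by q^(N+1) under \<open>euler\<close>.\<close>

lemma euler_theta: "fps_X ^ Suc N dvd euler (theta_fps N) + 3 * sigma_fps * theta_fps N"
proof -
  define d where "d = qpoch N ^ 3 - theta_fps N"
  have d: "fps_X ^ Suc N dvd d" unfolding d_def by (rule jacobi_cube)
  have t: "theta_fps N = qpoch N ^ 3 - d" by (simp add: d_def)
  have "euler (qpoch N ^ 3) = 3 * qpoch N ^ 2 * euler (qpoch N)"
    by (simp add: power3_eq_cube power2_eq_square euler_mult algebra_simps)
  hence "euler (theta_fps N) + 3 * sigma_fps * theta_fps N =
     3 * qpoch N ^ 2 * (euler (qpoch N) + sigma_fps * qpoch N) - (euler d + 3 * sigma_fps * d)"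
    unfolding t euler_diff by (simp add: algebra_simps power3_eq_cube power2_eq_square)
  moreover have "fps_X ^ Suc N dvd \<dots>"
    by (intro dvd_diff dvd_mult euler_qpoch dvd_add euler_dvd d)
  ultimately show ?thesis by simp
qed

subsection \<open>Denominators of the coefficients\<close>

definition upper_coeff :: "nat \<Rightarrow> nat \<Rightarrow> real" where
  "upper_coeff k l = (\<Prod>i\<in>{1..l}. real k / (real k + real i))"

definition lower_coeff :: "nat \<Rightarrow> nat \<Rightarrow> real" where
  "lower_coeff k l = (\<Prod>i\<in>{1..l}. (real k - real i) / real k)"

lemma upper_coeff_0 [simp]: "upper_coeff k 0 = 1" and lower_coeff_0 [simp]: "lower_coeff k 0 = 1"
  by (auto simp: upper_coeff_def lower_coeff_def)

lemma upper_coeff_Suc: "upper_coeff k (Suc l) = upper_coeff k l * (real k / (real k + real (Suc l)))"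
  and lower_coeff_Suc: "lower_coeff k (Suc l) = lower_coeff k l * ((real k - real (Suc l)) / real k)"
  by (auto simp: upper_coeff_def lower_coeff_def)

text \<open>The equation for w cut off after l = N. As tri l is at least l, the omitted terms do not
  affect coefficients up to q^N. The term l = 0 is F - 1.\<close>

definition zero_eq_fps :: "nat \<Rightarrow> nat \<Rightarrow> real fps \<Rightarrow> real fps" where
  "zero_eq_fps k N F = (\<Sum>l\<le>N. (-1) ^ l * fps_X ^ tri l *
      (fps_const (upper_coeff k l) * F ^ (l + 1) - fps_const (lower_coeff k l) * inverse F ^ l))"

text \<open>A class of functions of \<open>k\<close>, graded by the power of \<open>q\<close> they accompany. It is used once for the
  functions with denominator \<open>Q\<^sub>n\<close> and once for the bounded functions.\<close>

locale graded_family =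
  fixes P :: "nat \<Rightarrow> (nat \<Rightarrow> real) \<Rightarrow> bool"
  assumes P_cong: "(\<And>k. k \<ge> 1 \<Longrightarrow> c k = d k) \<Longrightarrow> P n c \<Longrightarrow> P n d"
    and P_zero: "P n (\<lambda>_. 0)"
    and P_one: "P 0 (\<lambda>_. 1)"
    and P_add: "P n c \<Longrightarrow> P n d \<Longrightarrow> P n (\<lambda>k. c k + d k)"
    and P_minus: "P n c \<Longrightarrow> P n (\<lambda>k. - c k)"
    and P_mult: "P i c \<Longrightarrow> P j d \<Longrightarrow> P (i + j) (\<lambda>k. c k * d k)"
    and P_upper_coeff: "P (tri l) (\<lambda>k. upper_coeff k l)"
    and P_lower_coeff: "P (tri l) (\<lambda>k. lower_coeff k l)"
begin

lemma P_sum: "(\<And>x. x \<in> S \<Longrightarrow> P n (c x)) \<Longrightarrow> P n (\<lambda>k. \<Sum>x\<in>S. c x k)"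
  by (induction S rule: infinite_finite_induct) (auto intro: P_zero P_add)

lemma P_diff: "P n c \<Longrightarrow> P n d \<Longrightarrow> P n (\<lambda>k. c k - d k)"
  using P_add[OF _ P_minus] by fastforce

lemma P_sign: "P n c \<Longrightarrow> P n (\<lambda>k. (-1) ^ (l :: nat) * c k)"
  by (cases "even l") (auto intro: P_minus)

definition fam :: "nat \<Rightarrow> (nat \<Rightarrow> real fps) \<Rightarrow> bool" where
  "fam N g \<longleftrightarrow> (\<forall>m\<le>N. P m (\<lambda>k. g k $ m))"

lemma fam_one: "fam N (\<lambda>_. 1)"
  unfolding fam_def by (auto simp: P_zero P_one)

lemma fam_mult: "fam N f \<Longrightarrow> fam N g \<Longrightarrow> fam N (\<lambda>k. f k * g k)"
  unfolding fam_def fps_mult_nth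
proof (intro allI impI P_sum)
  fix m i assume *: "\<forall>m\<le>N. P m (\<lambda>k. f k $ m)" "\<forall>m\<le>N. P m (\<lambda>k. g k $ m)" "m \<le> N" "i \<in> {0..m}"
  hence "P (i + (m - i)) (\<lambda>k. f k $ i * g k $ (m - i))" by (intro P_mult) auto
  thus "P m (\<lambda>k. f k $ i * g k $ (m - i))" using * by simp
qed

lemma fam_power: "fam N f \<Longrightarrow> fam N (\<lambda>k. f k ^ l)"
  by (induction l) (auto intro: fam_one fam_mult)

lemma fam_inverse:
  assumes f: "fam N f" and f0: "\<And>k. k \<ge> 1 \<Longrightarrow> f k $ 0 = 1"
  shows "fam N (\<lambda>k. inverse (f k))"
  unfolding fam_def
proof (intro allI impI)
  fix m assume "m \<le> N"
  thus "P m (\<lambda>k. inverse (f k) $ m)"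
  proof (induction m rule: less_induct)
    case (less m)
    show ?case
    proof (cases "m = 0")
      case True
      show ?thesis unfolding True by (rule P_cong[OF _ P_one]) (simp add: f0)
    next
      case False
      \<comment> \<open>The recursion for the coefficients of a reciprocal, solved with leading
        coefficient 1; the grades i and m - i add up to m.\<close>
      have "P m (\<lambda>k. - (\<Sum>i\<in>{1..m}. f k $ i * inverse (f k) $ (m - i)))"
      proof (intro P_minus P_sum)
        fix i assume i: "i \<in> {1..m}"
        hence "P (i + (m - i)) (\<lambda>k. f k $ i * inverse (f k) $ (m - i))"
          using less f unfolding fam_def by (intro P_mult) auto
        thus "P m (\<lambda>k. f k $ i * inverse (f k) $ (m - i))" using i by simp
      qed
      moreover have "- (\<Sum>i\<in>{1..m}. f k $ i * inverse (f k) $ (m - i)) = inverse (f k) $ m"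
        if "k \<ge> 1" for k
      proof -
        have "(f k * inverse (f k)) $ m = 0"
          using f0[OF that] False by (simp add: inverse_mult_eq_1')
        moreover have "{0..m} = insert 0 {1..m}" by auto
        ultimately show ?thesis using f0[OF that] by (simp add: fps_mult_nth)
      qed
      ultimately show ?thesis by (rule P_cong[rotated])
    qed
  qed
qed

lemma P_shift: "P (tri l) c \<Longrightarrow> tri l \<le> m \<Longrightarrow> fam (m - tri l) g \<Longrightarrow> P m (\<lambda>k. c k * g k $ (m - tri l))"
  using P_mult[of "tri l" c "m - tri l" "\<lambda>k. g k $ (m - tri l)"] by (auto simp: fam_def)

text \<open>The coefficient of q^n in the equation contains W_n only through the term l = 0. A term
  with l at least 1 is shifted by tri l, so it involves earlier coefficients only, and its total
  grade is tri l + (n - tri l) = n.\<close>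

lemma solution:
  assumes W0: "\<And>k. k \<ge> 1 \<Longrightarrow> W k $ 0 = 1"
    and eq: "\<And>k N. k \<ge> 1 \<Longrightarrow> fps_X ^ Suc N dvd zero_eq_fps k N (W k)"
  shows "fam N W"
proof (induction N)
  case 0
  show ?case unfolding fam_def by (auto intro!: P_cong[OF _ P_one] simp: W0)
next
  case (Suc N)
  define n where "n = Suc N"
  have fW: "fam m W" if "m < n" for m
    using Suc that unfolding fam_def n_def by auto
  have fV: "fam m (\<lambda>k. inverse (W k))" if "m < n" for m
    using fam_inverse fW[OF that] W0 by blast
  define R where "R k l = (if n < tri l then 0 else
      upper_coeff k l * (W k ^ (l + 1)) $ (n - tri l) - lower_coeff k l * (inverse (W k) ^ l) $ (n - tri l))" for k l
  have "P n (\<lambda>k. R k l)" if "l \<ge> 1" for l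
  proof (cases "n < tri l")
    case False
    moreover have "n - tri l < n" using that le_tri[of l] by (simp add: n_def)
    ultimately have "P n (\<lambda>k. upper_coeff k l * (W k ^ (l + 1)) $ (n - tri l) - lower_coeff k l * (inverse (W k) ^ l) $ (n - tri l))"
      by (intro P_diff P_shift P_upper_coeff P_lower_coeff fam_power fW fV) auto
    thus ?thesis using False by (simp add: R_def)
  qed (simp add: R_def P_zero)
  hence "P n (\<lambda>k. - (\<Sum>l\<in>{1..n}. (-1) ^ l * R k l))"
    by (intro P_minus P_sum P_sign) auto
  moreover have "- (\<Sum>l\<in>{1..n}. (-1) ^ l * R k l) = W k $ n" if "k \<ge> 1" for k
  proof -
    have "zero_eq_fps k n (W k) $ n = 0"
      using eq[OF that, of n] unfolding fps_X_power_dvd_iff by simp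
    also have "zero_eq_fps k n (W k) $ n = (\<Sum>l\<le>n. (-1) ^ l * R k l)"
      unfolding zero_eq_fps_def fps_sum_nth
    proof (intro sum.cong refl)
      fix l
      show "((-1) ^ l * fps_X ^ tri l * (fps_const (upper_coeff k l) * W k ^ (l + 1) - fps_const (lower_coeff k l) * inverse (W k) ^ l)) $ n = (-1) ^ l * R k l"
        by (cases "even l") (simp_all add: R_def mult.assoc fps_X_power_mult_nth)
    qed
    also have "{..n} = insert 0 {1..n}" by auto
    also have "(\<Sum>l\<in>insert 0 {1..n}. (-1) ^ l * R k l) = W k $ n + (\<Sum>l\<in>{1..n}. (-1) ^ l * R k l)"
      by (simp add: R_def n_def)
    finally show ?thesis by simp
  qed
  ultimately have "P n (\<lambda>k. W k $ n)" by (rule P_cong[rotated])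
  thus ?case using Suc unfolding fam_def n_def by (auto simp: le_Suc_eq)
qed

end

section \<open>Functions of k with denominator \<open>Q n\<close>\<close>

definition rational_Q :: "nat \<Rightarrow> (nat \<Rightarrow> real) \<Rightarrow> bool" where
  "rational_Q n c \<longleftrightarrow> (\<exists>p :: int poly. \<forall>k\<ge>1.
      c k = real_of_int (poly p (int k)) / real_of_int (poly (Q n) (int k)))"

lemma Q_extend: "n \<le> L \<Longrightarrow> Q n = monom 1 n * (\<Prod>l\<in>{1..L}. [:int l, 1:] ^ gam n l)"
  unfolding Q_def by (intro arg_cong2[where f = "(*)"] refl prod.mono_neutral_left) (auto simp: gam_eq_0)

text \<open>Floors are superadditive, so every exponent \<open>gam\<close> is superadditive in its
  first argument.\<close>

lemma Q_mult_dvd: "Q i * Q j dvd Q (i + j)"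
proof -
  have "gam i l + gam j l \<le> gam (i + j) l" for l
    unfolding gam_def distrib_left by (subst div_add1_eq) simp
  hence "(\<Prod>l\<in>{1..i+j}. [:int l, 1:] ^ (gam i l + gam j l)) dvd (\<Prod>l\<in>{1..i+j}. [:int l, 1:] ^ gam (i + j) l)"
    by (intro prod_dvd_prod le_imp_power_dvd)
  hence "monom 1 (i + j) * (\<Prod>l\<in>{1..i+j}. [:int l, 1:] ^ (gam i l + gam j l)) dvd Q (i + j)"
    unfolding Q_def by (intro mult_dvd_mono) auto
  also have "monom 1 (i + j) * (\<Prod>l\<in>{1..i+j}. [:int l, 1:] ^ (gam i l + gam j l)) = Q i * Q j"
    by (subst (1 2) Q_extend[where L = "i + j"])
       (auto simp: power_add prod.distrib mult_ac mult_monom)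
  finally show ?thesis .
qed

lemma rational_Q_of_dvd:
  assumes dvd: "q dvd Q n" and c: "\<And>k. k \<ge> 1 \<Longrightarrow> c k = real_of_int (poly p (int k)) / real_of_int (poly q (int k))"
  shows "rational_Q n c"
proof -
  obtain r where r: "Q n = q * r" using dvd by (elim dvdE)
  have "c k = real_of_int (poly (p * r) (int k)) / real_of_int (poly (Q n) (int k))" if "k \<ge> 1" for k
    using c[OF that] poly_Q_pos[OF that, of n] by (auto simp: r)
  thus ?thesis unfolding rational_Q_def by blast
qed

lemma graded_rational_Q: "graded_family rational_Q"
proof
  fix c d :: "nat \<Rightarrow> real" and n
  show "rational_Q n d" if "\<And>k. k \<ge> 1 \<Longrightarrow> c k = d k" "rational_Q n c"
    using that unfolding rational_Q_def by (metis (full_types))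
  show "rational_Q n (\<lambda>_. 0)"
    unfolding rational_Q_def by (intro exI[of _ 0]) auto
  show "rational_Q 0 (\<lambda>_. 1)"
    unfolding rational_Q_def by (intro exI[of _ 1]) (auto simp: Q_def)
  show "rational_Q n (\<lambda>k. c k + d k)" if cd: "rational_Q n c" "rational_Q n d"
  proof -
    obtain p q where "\<forall>k\<ge>1. c k = real_of_int (poly p (int k)) / real_of_int (poly (Q n) (int k))"
      "\<forall>k\<ge>1. d k = real_of_int (poly q (int k)) / real_of_int (poly (Q n) (int k))"
      using cd unfolding rational_Q_def by blast
    thus ?thesis unfolding rational_Q_def by (intro exI[of _ "p + q"]) (simp add: add_divide_distrib)
  qed
  show "rational_Q n (\<lambda>k. - c k)" if c: "rational_Q n c"
  proof -
    obtain p where "\<forall>k\<ge>1. c k = real_of_int (poly p (int k)) / real_of_int (poly (Q n) (int k))"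
      using c unfolding rational_Q_def by blast
    thus ?thesis unfolding rational_Q_def by (intro exI[of _ "- p"]) simp
  qed
  show "rational_Q (i + j) (\<lambda>k. c k * d k)" if cd: "rational_Q i c" "rational_Q j d" for i j
  proof -
    obtain p q where "\<forall>k\<ge>1. c k = real_of_int (poly p (int k)) / real_of_int (poly (Q i) (int k))"
      "\<forall>k\<ge>1. d k = real_of_int (poly q (int k)) / real_of_int (poly (Q j) (int k))"
      using cd unfolding rational_Q_def by blast
    thus ?thesis by (intro rational_Q_of_dvd[OF Q_mult_dvd, where p = "p * q"]) simp
  qed
next
  fix l
  \<comment> \<open>The denominator (k+1)...(k+l) of \<open>upper_coeff\<close> divides
    \<open>Q (tri l)\<close>: for i up to l, i(i+1) is at most l(l+1) = 2 tri l, so k+i occurs at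
    least once.\<close>
  have "(\<Prod>i\<in>{1..tri l}. [:int i, 1:] ^ (if i \<le> l then 1 else 0)) dvd (\<Prod>i\<in>{1..tri l}. [:int i, 1:] ^ gam (tri l) i)"
  proof (intro prod_dvd_prod le_imp_power_dvd)
    fix i assume i: "i \<in> {1..tri l}"
    show "(if i \<le> l then 1 else 0) \<le> gam (tri l) i"
    proof (cases "i \<le> l")
      case True
      hence "i * (i + 1) \<le> 2 * tri l" using mult_le_mono[of i l "i + 1" "l + 1"] by (simp add: tri_def)
      hence "i * (i + 1) div (i * (i + 1)) \<le> gam (tri l) i" unfolding gam_def by (rule div_le_mono)
      thus ?thesis using i by simp
    qed simp
  qed
  also have "(\<Prod>i\<in>{1..tri l}. [:int i, 1:] ^ (if i \<le> l then 1 else 0)) = (\<Prod>i\<in>{1..l}. [:int i, 1:])"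
    using le_tri[of l] by (intro prod.mono_neutral_cong_right) auto
  finally have "(\<Prod>i\<in>{1..l}. [:int i, 1:]) dvd Q (tri l)" unfolding Q_def by (rule dvd_mult)
  thus "rational_Q (tri l) (\<lambda>k. upper_coeff k l)"
    by (rule rational_Q_of_dvd[where p = "monom 1 l"])
       (auto simp: upper_coeff_def poly_monom poly_prod prod_dividef add.commute)
  \<comment> \<open>The denominator k^l of \<open>lower_coeff\<close> is already covered by the
    factor k^(tri l).\<close>
  have "monom 1 l dvd (monom 1 (tri l) :: int poly)"
    using le_tri[of l] by (auto simp: monom_altdef intro!: le_imp_power_dvd)
  hence "monom 1 l dvd Q (tri l)" unfolding Q_def by (rule dvd_mult2)
  thus "rational_Q (tri l) (\<lambda>k. lower_coeff k l)"
    by (rule rational_Q_of_dvd[where p = "\<Prod>i\<in>{1..l}. [:- int i, 1:]"])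
       (auto simp: lower_coeff_def poly_monom poly_prod prod_dividef)
qed

subsection \<open>The fixed point equation\<close>

lemma upper_coeff_nonneg: "upper_coeff k l \<ge> 0" and upper_coeff_le_1: "upper_coeff k l \<le> 1"
  unfolding upper_coeff_def by (auto intro!: prod_nonneg prod_le_1 simp: divide_le_eq_1)

lemma lower_coeff_eq_0: "k \<ge> 1 \<Longrightarrow> l \<ge> k \<Longrightarrow> lower_coeff k l = 0"
  unfolding lower_coeff_def by (auto intro!: prod_zero bexI[of _ k])

lemma lower_coeff_abs_le_1:
  assumes "k \<ge> 1"
  shows "\<bar>lower_coeff k l\<bar> \<le> 1"
proof (cases "l < k")
  case True
  hence "0 \<le> lower_coeff k l \<and> lower_coeff k l \<le> 1"
    unfolding lower_coeff_def by (intro conjI prod_nonneg prod_le_1) (auto simp: divide_simps)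
  thus ?thesis by simp
qed (use lower_coeff_eq_0[OF assms] in simp)

text \<open>With \<open>x = - k v / q\<^bsup>k-1\<^esup>\<close>, the \<open>l\<close>-th term collects the terms of index \<open>k + l\<close> and \<open>k - 1 - l\<close> of
  \<open>f(x; q)\<close>, up to a common factor; those are the ones of order \<open>q\<^bsup>l(l+1)/2\<^esup>\<close> relative to the
  dominant terms \<open>l = 0\<close>.\<close>

definition zterm :: "nat \<Rightarrow> nat \<Rightarrow> 'a \<Rightarrow> 'a \<Rightarrow> 'a :: {real_normed_field, banach}" where
  "zterm k l q x = (-1) ^ l * q ^ tri l *
     (of_real (upper_coeff k l) * x ^ (l + 1) - of_real (lower_coeff k l) * inverse x ^ l)"

text \<open>The term l = 0 of the full series is x - 1, so the fixed points are exactly the points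
  where that series, if summable, has sum 0.\<close>

definition zmap :: "nat \<Rightarrow> 'a \<Rightarrow> 'a \<Rightarrow> 'a :: {real_normed_field, banach}" where
  "zmap k q x = 1 - (\<Sum>l. zterm k (Suc l) q x)"

text \<open>The radii are the thresholds of \<open>fpt_dominant_term\<close>: every zero of f with 0
  < q < 1 leads to a parameter v in this set by \<open>fpt_zero_location\<close>.\<close>

definition annulus :: "'a :: real_normed_field set" where
  "annulus = {x. 1 / 4 \<le> norm x \<and> norm x \<le> 4}"

lemma annulus_nonzero: "x \<in> annulus \<Longrightarrow> x \<noteq> 0"
  by (auto simp: annulus_def)

lemma annulus_inverse: "x \<in> annulus \<Longrightarrow> norm (inverse x) \<le> 4"
  using le_imp_inverse_le[of "1 / 4" "norm x"] by (simp add: annulus_def norm_inverse)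

lemma cball_subset_annulus: "cball 1 (1 / 2) \<subseteq> annulus"
proof
  fix x :: 'a assume "x \<in> cball 1 (1 / 2)"
  hence "norm (1 - x) \<le> 1 / 2" by (simp add: dist_norm)
  moreover have "norm (1 :: 'a) - norm x \<le> norm (1 - x)" by (rule norm_triangle_ineq2)
  moreover have "norm x - norm (1 :: 'a) \<le> norm (1 - x)"
    using norm_triangle_ineq2[of x 1] by (simp add: norm_minus_commute)
  ultimately show "x \<in> annulus" by (simp add: annulus_def)
qed

lemma norm_sign_power: "norm ((-1) ^ l * q ^ tri l :: 'a :: real_normed_field) \<le> norm q ^ l" if "norm q \<le> 1"
proof -
  have "norm ((-1) ^ l * q ^ tri l) = norm q ^ tri l"
    by (simp add: norm_mult norm_power)
  also have "\<dots> \<le> norm q ^ l" using that le_tri[of l] by (intro power_decreasing) auto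
  finally show ?thesis .
qed

lemma zterm_bound:
  assumes "k \<ge> 1" "norm q \<le> 1" "x \<in> annulus"
  shows "norm (zterm k l q x) \<le> 5 * (4 * norm q) ^ l"
proof -
  have "norm (of_real (upper_coeff k l) * x ^ (l + 1)) \<le> 1 * 4 ^ (l + 1)"
    unfolding norm_mult norm_power using assms upper_coeff_nonneg[of k l] upper_coeff_le_1[of k l]
    by (intro mult_mono power_mono) (auto simp: annulus_def)
  moreover have "norm (of_real (lower_coeff k l) * inverse x ^ l) \<le> 1 * 4 ^ l"
    unfolding norm_mult norm_power using assms lower_coeff_abs_le_1[of k l] annulus_inverse[of x]
    by (intro mult_mono power_mono) auto
  ultimately have "norm (of_real (upper_coeff k l) * x ^ (l + 1) - of_real (lower_coeff k l) * inverse x ^ l) \<le> 5 * 4 ^ l"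
    by (intro order.trans[OF norm_triangle_ineq4]) simp
  hence "norm (zterm k l q x) \<le> norm q ^ l * (5 * 4 ^ l)"
    unfolding zterm_def norm_mult[of "(-1) ^ l * q ^ tri l"]
    using norm_sign_power[OF assms(2)] by (intro mult_mono) auto
  thus ?thesis by (simp add: power_mult_distrib mult_ac)
qed

lemma norm_power_diff_le:
  fixes x y :: "'a :: real_normed_field"
  assumes "norm x \<le> c" "norm y \<le> c" "c \<ge> 1"
  shows "norm (x ^ n - y ^ n) \<le> real n * c ^ n * norm (x - y)"
proof (induction n)
  case (Suc n)
  have "x ^ Suc n - y ^ Suc n = x * (x ^ n - y ^ n) + (x - y) * y ^ n" by (simp add: algebra_simps)
  also have "norm \<dots> \<le> norm x * norm (x ^ n - y ^ n) + norm (x - y) * norm y ^ n"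
    by (intro order.trans[OF norm_triangle_ineq]) (simp add: norm_mult norm_power)
  also have "\<dots> \<le> c * (real n * c ^ n * norm (x - y)) + norm (x - y) * (c * c ^ n)"
  proof (intro add_mono mult_mono Suc.IH mult_left_mono)
    have "norm y ^ n \<le> 1 * c ^ n" using assms by (simp add: power_mono)
    also have "\<dots> \<le> c * c ^ n" using assms by (intro mult_right_mono) auto
    finally show "norm y ^ n \<le> c * c ^ n" .
  qed (use assms in auto)
  finally show ?case by (simp add: algebra_simps)
qed simp

lemma zterm_lipschitz:
  assumes "k \<ge> 1" "norm q \<le> 1" "x \<in> annulus" "y \<in> annulus"
  shows "norm (zterm k l q x - zterm k l q y) \<le> 24 * (8 * norm q) ^ l * norm (x - y)"
proof -
  have xy: "norm x \<le> 4" "norm y \<le> 4" "norm (inverse x) \<le> 4" "norm (inverse y) \<le> 4" "x \<noteq> 0" "y \<noteq> 0"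
    using assms annulus_inverse annulus_nonzero by (auto simp: annulus_def)
  have "norm (of_real (upper_coeff k l) * (x ^ (l + 1) - y ^ (l + 1))) \<le> 1 * (real (l + 1) * 4 ^ (l + 1) * norm (x - y))"
    unfolding norm_mult using xy upper_coeff_nonneg[of k l] upper_coeff_le_1[of k l]
    by (intro mult_mono norm_power_diff_le) auto
  moreover have "norm (of_real (lower_coeff k l) * (inverse x ^ l - inverse y ^ l)) \<le> 1 * (real l * 4 ^ l * (16 * norm (x - y)))"
    unfolding norm_mult
  proof (intro mult_mono)
    have "inverse x - inverse y = inverse x * (y - x) * inverse y" using xy by (simp add: field_simps)
    hence "norm (inverse x - inverse y) = norm (inverse x) * norm (x - y) * norm (inverse y)"
      by (simp add: norm_mult norm_minus_commute)
    also have "\<dots> \<le> 4 * norm (x - y) * 4" using xy by (intro mult_mono) auto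
    finally have "norm (inverse x - inverse y) \<le> 16 * norm (x - y)" by simp
    hence "real l * 4 ^ l * norm (inverse x - inverse y) \<le> real l * 4 ^ l * (16 * norm (x - y))"
      by (intro mult_left_mono) auto
    thus "norm (inverse x ^ l - inverse y ^ l) \<le> real l * 4 ^ l * (16 * norm (x - y))"
      using norm_power_diff_le[of "inverse x" 4 "inverse y" l] xy by simp
  qed (use lower_coeff_abs_le_1[OF assms(1)] in auto)
  ultimately have "norm (of_real (upper_coeff k l) * (x ^ (l + 1) - y ^ (l + 1)) - of_real (lower_coeff k l) * (inverse x ^ l - inverse y ^ l))
     \<le> (20 * real l + 4) * 4 ^ l * norm (x - y)"
    by (intro order.trans[OF norm_triangle_ineq4]) (simp add: algebra_simps)
  \<comment> \<open>The linear factor coming from the differences of powers is absorbed into 2^l, so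
    that the bound stays geometric.\<close>
  also have "\<dots> \<le> 24 * 2 ^ l * 4 ^ l * norm (x - y)"
  proof (intro mult_right_mono)
    have "real l \<le> 2 ^ l" using less_exp[of l] of_nat_mono[of l "2 ^ l"] by simp
    moreover have "(1::real) \<le> 2 ^ l" by simp
    ultimately show "20 * real l + 4 \<le> 24 * 2 ^ l" by linarith
  qed auto
  also have "\<dots> = 24 * 8 ^ l * norm (x - y)" by (simp flip: power_mult_distrib)
  finally have "norm ((-1) ^ l * q ^ tri l) * norm (of_real (upper_coeff k l) * (x ^ (l + 1) - y ^ (l + 1)) - of_real (lower_coeff k l) * (inverse x ^ l - inverse y ^ l))
     \<le> norm q ^ l * (24 * 8 ^ l * norm (x - y))"
    by (intro mult_mono norm_sign_power assms) auto
  also have "norm ((-1) ^ l * q ^ tri l) * norm (of_real (upper_coeff k l) * (x ^ (l + 1) - y ^ (l + 1)) - of_real (lower_coeff k l) * (inverse x ^ l - inverse y ^ l))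
      = norm (zterm k l q x - zterm k l q y)"
    unfolding norm_mult[symmetric] zterm_def by (rule arg_cong[where f = norm]) (simp add: algebra_simps)
  finally show ?thesis by (simp add: power_mult_distrib mult_ac)
qed

text \<open>Small enough for the contraction constant to be at most 1/4, uniformly in \<open>k\<close>.\<close>

definition q_radius :: real where "q_radius = 1 / 1000"

lemma q_radius_pos: "q_radius > 0" by (simp add: q_radius_def)

context
  fixes k :: nat and q :: "'a :: {real_normed_field, banach}"
  assumes k: "k \<ge> 1" and q: "norm q \<le> q_radius"
begin

lemma q_le_1: "norm q \<le> 1"
  using q by (simp add: q_radius_def)

lemma zterm_bound_const: "x \<in> annulus \<Longrightarrow> norm (zterm k l q x) \<le> 5 * (1 / 250) ^ l"
  using q by (intro order.trans[OF zterm_bound[OF k q_le_1]] mult_left_mono power_mono)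
    (auto simp: q_radius_def)

lemma zterm_summable: "x \<in> annulus \<Longrightarrow> summable (\<lambda>l. zterm k l q x)"
  by (rule summable_comparison_test'[where N = 0 and g = "\<lambda>l. 5 * (1 / 250) ^ l"])
     (auto intro!: summable_mult summable_geometric zterm_bound_const)

lemma zmap_eq: "x \<in> annulus \<Longrightarrow> x - zmap k q x = (\<Sum>l. zterm k l q x)"
  using suminf_split_head[OF zterm_summable[of x]] annulus_nonzero[of x]
  by (simp add: zmap_def zterm_def[of k 0])

text \<open>The series starts at l = 1 and has norm at most 5/249. The whole annulus is thus sent
  into a disc inside it, on which Banach's theorem applies.\<close>

lemma zmap_near_1:
  assumes "x \<in> annulus"
  shows "zmap k q x \<in> cball 1 (1 / 2)"
proof -
  have s: "(\<lambda>l. 5 * (1 / 250 :: real) ^ Suc l) sums (5 * ((1 / 250) * (1 / (1 - 1 / 250))))"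
    unfolding power_Suc by (intro sums_mult geometric_sums) simp
  have "norm (\<Sum>l. zterm k (Suc l) q x) \<le> (\<Sum>l. 5 * (1 / 250) ^ Suc l)"
    using s by (intro norm_suminf_le zterm_bound_const assms sums_summable)
  also have "\<dots> \<le> 1 / 2" using s by (simp add: sums_iff)
  finally show ?thesis by (simp add: zmap_def dist_norm)
qed

lemma zmap_contraction:
  assumes x: "x \<in> annulus" and y: "y \<in> annulus"
  shows "dist (zmap k q x) (zmap k q y) \<le> 1 / 4 * dist x y"
proof -
  have s: "(\<lambda>l. 24 * (1 / 125) ^ Suc l * norm (x - y)) sums (24 * ((1 / 125) * (1 / (1 - 1 / 125))) * norm (x - y))"
    unfolding power_Suc by (intro sums_mult2 sums_mult geometric_sums) simp
  have "summable (\<lambda>l. zterm k (Suc l) q x)" "summable (\<lambda>l. zterm k (Suc l) q y)"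
    using zterm_summable x y by (subst summable_Suc_iff; blast)+
  hence "zmap k q y - zmap k q x = (\<Sum>l. zterm k (Suc l) q x - zterm k (Suc l) q y)"
    by (simp add: zmap_def suminf_diff)
  also have "norm \<dots> \<le> (\<Sum>l. 24 * (1 / 125) ^ Suc l * norm (x - y))"
  proof (intro norm_suminf_le sums_summable[OF s])
    fix l
    have "norm (zterm k (Suc l) q x - zterm k (Suc l) q y) \<le> 24 * (8 * norm q) ^ Suc l * norm (x - y)"
      by (rule zterm_lipschitz[OF k q_le_1 x y])
    also have "\<dots> \<le> 24 * (1 / 125) ^ Suc l * norm (x - y)"
      using q by (intro mult_right_mono mult_left_mono power_mono) (auto simp: q_radius_def)
    finally show "norm (zterm k (Suc l) q x - zterm k (Suc l) q y) \<le> 24 * (1 / 125) ^ Suc l * norm (x - y)" .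
  qed
  also have "\<dots> = 24 * ((1 / 125) * (1 / (1 - 1 / 125))) * norm (x - y)"
    using s by (simp add: sums_iff)
  also have "\<dots> \<le> 1 / 4 * norm (x - y)"
    by (intro mult_right_mono) auto
  finally show ?thesis by (simp add: dist_norm norm_minus_commute)
qed

lemma zmap_fixpoint_unique:
  assumes "x \<in> annulus" "y \<in> annulus" "zmap k q x = x" "zmap k q y = y"
  shows "x = y"
proof -
  have "dist x y \<le> 1 / 4 * dist x y" using zmap_contraction[of x y] assms by simp
  hence "dist x y \<le> 0" by simp
  thus ?thesis by simp
qed

lemma zmap_fixpoint_exists: "\<exists>x\<in>cball 1 (1 / 2). zmap k q x = x"
proof -
  have "\<exists>!x\<in>cball 1 (1 / 2). zmap k q x = x"
  proof (rule Banach_fix[where c = "1 / 4"])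
    show "complete (cball 1 (1 / 2) :: 'a set)"
      by (simp add: complete_eq_closed)
    show "zmap k q ` cball 1 (1 / 2) \<subseteq> cball 1 (1 / 2)"
      using cball_subset_annulus zmap_near_1 by blast
    show "dist (zmap k q x) (zmap k q y) \<le> 1 / 4 * dist x y" if "x \<in> cball 1 (1 / 2)" "y \<in> cball 1 (1 / 2)" for x y
      using that cball_subset_annulus zmap_contraction by blast
  qed auto
  thus ?thesis by blast
qed

end

section \<open>The fixed point as a function of q\<close>

definition zfix :: "nat \<Rightarrow> 'a \<Rightarrow> 'a :: {real_normed_field, banach}" where
  "zfix k q = (SOME x. x \<in> cball 1 (1 / 2) \<and> zmap k q x = x)"

lemma zfix:
  assumes "k \<ge> 1" "norm q \<le> q_radius"
  shows zfix_cball: "zfix k q \<in> cball 1 (1 / 2)" and zfix_eq: "zmap k q (zfix k q) = zfix k q"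
  using someI_ex[of "\<lambda>x. x \<in> cball 1 (1 / 2) \<and> zmap k q x = x"] zmap_fixpoint_exists[OF assms]
  unfolding zfix_def by blast+

lemma zfix_annulus: "k \<ge> 1 \<Longrightarrow> norm q \<le> q_radius \<Longrightarrow> zfix k q \<in> annulus"
  using zfix_cball cball_subset_annulus by blast

text \<open>Links the real fixed points, which describe the zeros, with the complex ones, which are
  holomorphic in q: an embedded real fixed point is a complex fixed point, and these are unique in
  the annulus.\<close>

lemma zfix_of_real:
  assumes "k \<ge> 1" "norm (q :: real) \<le> q_radius"
  shows "zfix k (complex_of_real q) = complex_of_real (zfix k q)"
proof (rule zmap_fixpoint_unique)
  have "zmap k (complex_of_real q) (complex_of_real x) = complex_of_real (zmap k q x)" if "x \<in> annulus" for x
  proof -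
    have "zterm k l (complex_of_real q) (complex_of_real x) = complex_of_real (zterm k l q x)" for l
      by (simp add: zterm_def)
    moreover have "summable (\<lambda>l. zterm k (Suc l) q x)"
      using zterm_summable[OF assms that] by (subst summable_Suc_iff)
    ultimately show ?thesis by (simp add: zmap_def suminf_of_real)
  qed
  thus "zmap k (complex_of_real q) (complex_of_real (zfix k q)) = complex_of_real (zfix k q)"
    using assms by (simp add: zfix_annulus zfix_eq)
  show "complex_of_real (zfix k q) \<in> annulus"
    using zfix_annulus[OF assms] by (simp add: annulus_def)
qed (use assms in \<open>auto simp: zfix_annulus zfix_eq\<close>)

lemma holomorphic_zmap:
  assumes k: "k \<ge> 1" and g: "g holomorphic_on ball 0 q_radius"
    and g_ann: "\<And>q. q \<in> ball 0 q_radius \<Longrightarrow> g q \<in> annulus"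
  shows "(\<lambda>q. zmap k q (g q)) holomorphic_on ball 0 q_radius"
proof -
  have "(\<lambda>q. \<Sum>l. zterm k (Suc l) q (g q)) holomorphic_on ball 0 q_radius"
  proof (rule holomorphic_uniform_sequence[where f = "\<lambda>n q. \<Sum>l<n. zterm k (Suc l) q (g q)"])
    have "g q \<noteq> 0" if "norm q < q_radius" for q using g_ann[of q] that by (auto dest: annulus_nonzero)
    thus "(\<lambda>q. \<Sum>l<n. zterm k (Suc l) q (g q)) holomorphic_on ball 0 q_radius" for n
      unfolding zterm_def by (intro holomorphic_intros g) auto
    have u: "uniform_limit (ball 0 q_radius) (\<lambda>n q. \<Sum>l<n. zterm k (Suc l) q (g q))
         (\<lambda>q. \<Sum>l. zterm k (Suc l) q (g q)) sequentially"
    proof (rule Weierstrass_m_test)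
      show "norm (zterm k (Suc l) q (g q)) \<le> 5 * (1 / 250) ^ Suc l" if "q \<in> ball 0 q_radius" for l q
        using that by (intro zterm_bound_const g_ann k) auto
      show "summable (\<lambda>l. 5 * (1 / 250 :: real) ^ Suc l)"
        by (subst summable_Suc_iff) (intro summable_mult summable_geometric, simp)
    qed
    fix q :: complex assume "q \<in> ball 0 q_radius"
    then obtain d where "d > 0" "cball q d \<subseteq> ball 0 q_radius"
      using open_ball[of "0 :: complex" q_radius] unfolding open_contains_cball by blast
    thus "\<exists>d>0. cball q d \<subseteq> ball 0 q_radius \<and> uniform_limit (cball q d)
        (\<lambda>n q. \<Sum>l<n. zterm k (Suc l) q (g q)) (\<lambda>q. \<Sum>l. zterm k (Suc l) q (g q)) sequentially"
      using uniform_limit_on_subset[OF u] by blast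
  qed auto
  thus ?thesis unfolding zmap_def by (intro holomorphic_intros)
qed

text \<open>The iterates of \<open>zmap\<close> from the constant 1 are holomorphic and converge
  uniformly, with error at most 4^(-n) throughout the disc.\<close>

lemma holomorphic_zfix:
  assumes k: "k \<ge> 1"
  shows "zfix k holomorphic_on ball (0 :: complex) q_radius"
proof -
  define g :: "nat \<Rightarrow> complex \<Rightarrow> complex" where "g n q = (zmap k q ^^ n) 1" for n q
  have g_cball: "g n q \<in> cball 1 (1 / 2)" if "q \<in> ball 0 q_radius" for n q
  proof (induction n)
    case (Suc n)
    thus ?case using that k cball_subset_annulus by (auto simp: g_def intro!: zmap_near_1 simp del: mem_cball)
  qed (simp add: g_def)
  have g_hol: "g n holomorphic_on ball 0 q_radius" for n
  proof (induction n)
    case (Suc n)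
    have "(\<lambda>q. zmap k q (g n q)) holomorphic_on ball 0 q_radius"
      using g_cball cball_subset_annulus by (intro holomorphic_zmap k Suc) blast
    thus ?case by (simp add: g_def)
  qed (simp add: g_def)
  have g_dist: "dist (g n q) (zfix k q) \<le> (1 / 4) ^ n" if q: "q \<in> ball 0 q_radius" for n q
  proof (induction n)
    case 0
    show ?case using zfix_cball[of k q] k q by (simp add: g_def)
  next
    case (Suc n)
    have "dist (zmap k q (g n q)) (zmap k q (zfix k q)) \<le> 1 / 4 * dist (g n q) (zfix k q)"
      using q k g_cball[OF q] cball_subset_annulus by (intro zmap_contraction zfix_annulus) auto
    thus ?case using Suc q k by (simp add: g_def zfix_eq)
  qed
  have u: "uniform_limit (ball 0 q_radius) g (zfix k) sequentially"
  proof (rule uniform_limitI)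
    fix e :: real assume "e > 0"
    moreover have "(\<lambda>n. (1 / 4 :: real) ^ n) \<longlonglongrightarrow> 0" by (intro LIMSEQ_power_zero) simp
    ultimately have "eventually (\<lambda>n. (1 / 4 :: real) ^ n < e) sequentially"
      using order_tendstoD(2) by blast
    thus "\<forall>\<^sub>F n in sequentially. \<forall>q\<in>ball 0 q_radius. dist (g n q) (zfix k q) < e"
      by (rule eventually_mono) (meson g_dist le_less_trans)
  qed
  show ?thesis
  proof (rule holomorphic_uniform_sequence[OF _ g_hol])
    fix q :: complex assume "q \<in> ball 0 q_radius"
    then obtain d where "d > 0" "cball q d \<subseteq> ball 0 q_radius"
      using open_ball[of "0 :: complex" q_radius] unfolding open_contains_cball by blast
    thus "\<exists>d>0. cball q d \<subseteq> ball 0 q_radius \<and> uniform_limit (cball q d) g (zfix k) sequentially"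
      using uniform_limit_on_subset[OF u] by blast
  qed auto
qed

text \<open>Takes real parts of the complex Taylor series; powers of a real q are real, so only the
  real parts of the coefficients remain.\<close>

lemma real_power_series_of_holomorphic:
  fixes f :: "complex \<Rightarrow> complex" and h :: "real \<Rightarrow> real"
  assumes "f holomorphic_on ball 0 r" "\<forall>q. 0 < q \<and> q < r \<longrightarrow> f (complex_of_real q) = complex_of_real (h q)"
  shows "\<exists>c. \<forall>q. 0 < q \<and> q < r \<longrightarrow> (\<lambda>n. c n * q ^ n) sums h q"
proof (intro exI allI impI)
  fix q :: real assume q: "0 < q \<and> q < r"
  have "(\<lambda>n. (deriv ^^ n) f 0 / fact n * (complex_of_real q - 0) ^ n) sums f (complex_of_real q)"
    using q by (intro holomorphic_power_series[OF assms(1)]) auto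
  hence "(\<lambda>n. Re ((deriv ^^ n) f 0 / fact n * (complex_of_real q - 0) ^ n)) sums Re (f (complex_of_real q))"
    by (rule sums_Re)
  moreover have "Re (z * (complex_of_real q - 0) ^ n) = Re z * q ^ n" for z n
    by (simp flip: of_real_power)
  ultimately show "(\<lambda>n. Re ((deriv ^^ n) f 0 / fact n) * q ^ n) sums h q"
    by (simp only: assms(2)[rule_format, OF q] Re_complex_of_real)
qed

subsection \<open>Location of the zeros\<close>

definition fterm :: "real \<Rightarrow> real \<Rightarrow> nat \<Rightarrow> real" where
  "fterm x q n = x ^ n / fact n * q ^ (n * (n - 1) div 2)"

lemma fterm_0 [simp]: "fterm x q 0 = 1"
  by (simp add: fterm_def)

lemma fterm_Suc: "fterm x q (Suc n) = fterm x q n * (x * q ^ n / real (Suc n))"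
proof -
  have "Suc n * (Suc n - 1) = n * (n - 1) + n * 2"
    by (cases n) (auto simp: algebra_simps)
  hence "Suc n * (Suc n - 1) div 2 = n * (n - 1) div 2 + n"
    by (simp only: div_mult_self1)
  thus ?thesis unfolding fterm_def by (simp add: power_add field_simps)
qed

lemma fterm_nonzero: "x \<noteq> 0 \<Longrightarrow> q \<noteq> 0 \<Longrightarrow> fterm x q n \<noteq> 0"
  by (simp add: fterm_def)

lemma fterm_summable:
  assumes "\<bar>q\<bar> \<le> 1"
  shows "summable (fterm x q)"
proof (rule summable_comparison_test'[where N = 0])
  show "summable (\<lambda>n. inverse (fact n) * \<bar>x\<bar> ^ n)" by (rule summable_exp)
  fix n
  have "\<bar>x\<bar> ^ n / fact n * \<bar>q\<bar> ^ (n * (n - 1) div 2) \<le> \<bar>x\<bar> ^ n / fact n * 1"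
    using assms by (intro mult_left_mono power_le_one) auto
  thus "norm (fterm x q n) \<le> inverse (fact n) * \<bar>x\<bar> ^ n"
    by (simp add: fterm_def abs_mult power_abs field_simps)
qed

lemma fpt_eq: "fpt x q = (\<Sum>n. fterm x q n)"
  by (simp add: fpt_def fterm_def)

context
  fixes k :: nat and q v x :: real
  assumes k: "k \<ge> 1" and q: "0 < q" and v: "v > 0"
  defines "x \<equiv> - (real k * v / q ^ (k - 1))"
begin

text \<open>The ratio of the terms of index l+k+1 and l+k is -k v q^(l+1) / (k+l+1); the exponents
  of q accumulate to tri l.\<close>

lemma fterm_upper:
  "fterm x q (l + k) = fterm x q k / v * ((-1) ^ l * q ^ tri l * (upper_coeff k l * v ^ (l + 1)))"
proof (induction l)
  case (Suc l)
  obtain k' where k': "k = Suc k'" using k by (cases k) auto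
  have "x * q ^ (l + k) = - (real k * v * q ^ Suc l)"
    using q by (simp add: x_def k' power_add)
  hence "fterm x q (Suc l + k) = fterm x q (l + k) * (- (real k * v * q ^ Suc l) / real (Suc (l + k)))"
    by (simp only: add_Suc fterm_Suc)
  also have "\<dots> = fterm x q k / v * ((-1) ^ Suc l * q ^ tri (Suc l) * (upper_coeff k (Suc l) * v ^ (Suc l + 1)))"
    unfolding Suc.IH tri_Suc power_add upper_coeff_Suc by (simp add: algebra_simps)
  finally show ?case .
qed (use v in simp)

lemma fterm_lower:
  "l < k \<Longrightarrow> fterm x q (k - Suc l) = - (fterm x q k / v * ((-1) ^ l * q ^ tri l * (lower_coeff k l * inverse v ^ l)))"
proof (induction l)
  case 0
  have "fterm x q k = fterm x q (k - 1) * (x * q ^ (k - 1) / real k)"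
    using fterm_Suc[of x q "k - 1"] k by simp
  \<comment> \<open>The scaling of x is chosen for this: v is minus the ratio of the two dominant
    terms, of index k and k-1.\<close>
  also have "x * q ^ (k - 1) / real k = - v" using q k by (simp add: x_def)
  finally show ?case using v by simp
next
  case (Suc l)
  define n where "n = k - Suc (Suc l)"
  have n: "k - Suc l = Suc n" "real (Suc n) = real k - real (Suc l)" "k - 1 = n + Suc l"
    using Suc.prems by (auto simp: n_def)
  have "x * q ^ n = - (real k * v / q ^ Suc l)"
    using q unfolding x_def n(3) power_add by simp
  hence "fterm x q (Suc n) = fterm x q n * (- (real k * v / q ^ Suc l) / (real k - real (Suc l)))"
    by (simp only: fterm_Suc n(2)[symmetric])
  \<comment> \<open>Solves the ratio identity for the earlier term, in abstract variables so that
    the products k v and q^(l+1) stay intact.\<close>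
  moreover have "F = - T * (d * p / K)" if "T = F * (- (K / p) / d)" "K \<noteq> 0" "p \<noteq> 0" "d \<noteq> 0"
    for F T K p d :: real
    using that by (simp add: field_simps)
  moreover have "real k * v \<noteq> 0" "q ^ Suc l \<noteq> 0" "real k - real (Suc l) \<noteq> 0"
    using q v k Suc.prems by auto
  ultimately have "fterm x q n = - fterm x q (k - Suc l) * ((real k - real (Suc l)) * q ^ Suc l / (real k * v))"
    unfolding n(1) by blast
  also have "\<dots> = - (fterm x q k / v * ((-1) ^ Suc l * q ^ tri (Suc l) * (lower_coeff k (Suc l) * inverse v ^ Suc l)))"
    unfolding Suc.IH[OF Suc_lessD[OF Suc.prems]] tri_Suc power_add lower_coeff_Suc
    by (simp add: divide_inverse mult_ac)
  finally show ?case by (simp only: n_def)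
qed

lemma fpt_normal_form:
  assumes q': "q \<le> q_radius" and v': "v \<in> annulus"
  shows "fpt x q = fterm x q k / v * (v - zmap k q v)"
proof -
  let ?K = "fterm x q k / v"
  have q1: "\<bar>q\<bar> \<le> 1" "norm q \<le> q_radius" using q q' by (auto simp: q_radius_def)
  have "(\<lambda>l. fterm x q (l + k)) sums (\<Sum>l. fterm x q (l + k))"
    using fterm_summable[OF q1(1)] by (intro summable_sums summable_ignore_initial_segment)
  \<comment> \<open>The finitely many terms below k are reversed and padded with zeros; this matches
    \<open>zterm\<close>, where \<open>lower_coeff k l\<close> vanishes for l at least k.\<close>
  moreover have "(\<lambda>l. if l \<in> {..<k} then fterm x q (k - Suc l) else 0) sums (\<Sum>l<k. fterm x q (k - Suc l))"
    by (rule sums_If_finite_set) simp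
  ultimately have "(\<lambda>l. fterm x q (l + k) + (if l \<in> {..<k} then fterm x q (k - Suc l) else 0)) sums
      ((\<Sum>l. fterm x q (l + k)) + (\<Sum>l<k. fterm x q (k - Suc l)))"
    by (rule sums_add)
  also have "(\<lambda>l. fterm x q (l + k) + (if l \<in> {..<k} then fterm x q (k - Suc l) else 0)) = (\<lambda>l. ?K * zterm k l q v)"
  proof
    fix l
    show "fterm x q (l + k) + (if l \<in> {..<k} then fterm x q (k - Suc l) else 0) = ?K * zterm k l q v"
      using fterm_upper[of l] fterm_lower[of l] lower_coeff_eq_0[OF k, of l]
      by (auto simp: zterm_def algebra_simps)
  qed
  also have "(\<Sum>l. fterm x q (l + k)) + (\<Sum>l<k. fterm x q (k - Suc l)) = fpt x q"
    unfolding fpt_eq sum.nat_diff_reindex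
    using suminf_split_initial_segment[OF fterm_summable[OF q1(1)]] by simp
  finally have "(\<lambda>l. ?K * zterm k l q v) sums fpt x q" .
  moreover have "(\<lambda>l. ?K * zterm k l q v) sums (?K * (\<Sum>l. zterm k l q v))"
    using zterm_summable[OF k q1(2) v'] by (intro sums_mult summable_sums)
  ultimately show ?thesis
    using zmap_eq[OF k q1(2) v'] sums_unique2 by metis
qed

lemma fpt_zero_iff:
  assumes q': "q \<le> q_radius" and v': "v \<in> annulus"
  shows "fpt x q = 0 \<longleftrightarrow> v = zfix k q"
proof -
  have q1: "norm q \<le> q_radius" using q q' by auto
  have "x \<noteq> 0" using k q v by (simp add: x_def)
  hence "fpt x q = 0 \<longleftrightarrow> zmap k q v = v"
    using fpt_normal_form[OF assms] fterm_nonzero[of x q k] q v by auto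
  also have "\<dots> \<longleftrightarrow> v = zfix k q"
    using zmap_fixpoint_unique[OF k q1 v' zfix_annulus[OF k q1]] zfix_eq[OF k q1] by auto
  finally show ?thesis .
qed

end

text \<open>If the ratios of consecutive terms jump from at least 4 to at most 1/4, the term at the
  jump dominates the sum of all the others.\<close>

lemma fpt_dominant_term:
  assumes q: "0 < q" "q \<le> 1" and y: "y > 0"
    and lo: "\<And>n. n < j \<Longrightarrow> y * q ^ n / real (Suc n) \<ge> 4"
    and hi: "\<And>n. n \<ge> j \<Longrightarrow> y * q ^ n / real (Suc n) \<le> 1 / 4"
  shows "fpt (- y) q \<noteq> 0"
proof
  assume zero: "fpt (- y) q = 0"
  define t where "t = fterm (- y) q"
  have t_Suc: "\<bar>t (Suc n)\<bar> = \<bar>t n\<bar> * (y * q ^ n / real (Suc n))" for n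
    using q y by (simp add: t_def fterm_Suc abs_mult)
  have up: "\<bar>t (m + j)\<bar> \<le> (1 / 4) ^ m * \<bar>t j\<bar>" for m
  proof (induction m)
    case (Suc m)
    have "\<bar>t (Suc (m + j))\<bar> \<le> \<bar>t (m + j)\<bar> * (1 / 4)"
      unfolding t_Suc by (intro mult_left_mono hi) auto
    thus ?case using Suc by simp
  qed simp
  have down: "m \<le> j \<Longrightarrow> \<bar>t (j - m)\<bar> \<le> (1 / 4) ^ m * \<bar>t j\<bar>" for m
  proof (induction m)
    case (Suc m)
    have "\<bar>t (j - Suc m)\<bar> * 4 \<le> \<bar>t (Suc (j - Suc m))\<bar>"
      unfolding t_Suc using Suc.prems by (intro mult_left_mono lo) auto
    moreover have "Suc (j - Suc m) = j - m" using Suc.prems by simp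
    ultimately show ?case using Suc by simp
  qed simp
  have g: "(\<lambda>m. (1 / 4) ^ Suc m * \<bar>t j\<bar>) sums (1 / 4 * (1 / (1 - 1 / 4)) * \<bar>t j\<bar>)"
    unfolding power_Suc by (intro sums_mult2 sums_mult geometric_sums) simp
  have "\<bar>\<Sum>m<j. t m\<bar> \<le> (\<Sum>m<j. (1 / 4) ^ Suc m * \<bar>t j\<bar>)"
  proof -
    have "(\<Sum>m<j. t m) = (\<Sum>m<j. t (j - Suc m))" by (rule sum.nat_diff_reindex[symmetric])
    also have "\<bar>\<dots>\<bar> \<le> (\<Sum>m<j. \<bar>t (j - Suc m)\<bar>)" by (rule sum_abs)
    also have "\<dots> \<le> (\<Sum>m<j. (1 / 4) ^ Suc m * \<bar>t j\<bar>)" by (intro sum_mono down) auto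
    finally show ?thesis .
  qed
  also have "\<dots> \<le> (\<Sum>m. (1 / 4) ^ Suc m * \<bar>t j\<bar>)"
    by (intro sum_le_suminf sums_summable[OF g]) auto
  also have "\<dots> = \<bar>t j\<bar> / 3" using g by (simp add: sums_iff)
  finally have A: "\<bar>\<Sum>m<j. t m\<bar> \<le> \<bar>t j\<bar> / 3" .
  have "norm (\<Sum>m. t (m + Suc j)) \<le> (\<Sum>m. (1 / 4) ^ Suc m * \<bar>t j\<bar>)"
    using up[of "Suc _"] by (intro norm_suminf_le sums_summable[OF g]) simp
  also have "\<dots> = \<bar>t j\<bar> / 3" using g by (simp add: sums_iff)
  finally have B: "\<bar>\<Sum>m. t (m + Suc j)\<bar> \<le> \<bar>t j\<bar> / 3" by simp
  have "summable t" unfolding t_def using q by (intro fterm_summable) auto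
  hence "(\<Sum>n. t n) = (\<Sum>m. t (m + Suc j)) + (\<Sum>m<Suc j. t m)"
    by (rule suminf_split_initial_segment)
  hence "0 = (\<Sum>m. t (m + Suc j)) + (\<Sum>m<j. t m) + t j"
    using zero by (simp add: fpt_eq t_def)
  hence "\<bar>t j\<bar> \<le> 2 / 3 * \<bar>t j\<bar>" using A B by linarith
  hence "t j = 0" by simp
  moreover have "t j \<noteq> 0" unfolding t_def using q y by (intro fterm_nonzero) auto
  ultimately show False by simp
qed

lemma fpt_pos: "x \<ge> 0 \<Longrightarrow> 0 < q \<Longrightarrow> q \<le> 1 \<Longrightarrow> fpt x q > 0"
  unfolding fpt_eq
  by (rule suminf_pos2[where i = 0]) (auto intro!: fterm_summable simp: fterm_def)

text \<open>The moduli \<rho> of the ratios of consecutive terms decrease. If they jumped from at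
  least 4 to at most 1/4, one term would dominate, so at a zero some ratio lies strictly in between;
  that ratio is v.\<close>

lemma fpt_zero_location:
  assumes q: "0 < q" "q \<le> 1" and zero: "fpt x q = 0"
  obtains n v where "n \<ge> 1" "1 / 4 < v" "v < 4" "x = - (real n * v / q ^ (n - 1))"
proof -
  define y where "y = - x"
  define \<rho> where "\<rho> n = y * q ^ n / real (Suc n)" for n
  have y: "y > 0" using fpt_pos[of x q] assms by (force simp: y_def)
  have mono: "\<rho> n \<le> \<rho> m" if "m \<le> n" for m n
    unfolding \<rho>_def using q y that by (intro frac_le mult_left_mono power_decreasing) auto
  obtain N :: nat where N: "4 * y < real N" using reals_Archimedean2 by blast
  have "\<rho> N \<le> y * 1 / real (Suc N)"
    unfolding \<rho>_def using q y by (intro divide_right_mono mult_left_mono power_le_one) auto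
  also have "\<dots> \<le> 1 / 4" using N by (simp add: field_simps)
  finally have ex: "\<exists>n. \<rho> n \<le> 1 / 4" by blast
  define j where "j = (LEAST n. \<rho> n \<le> 1 / 4)"
  have "\<rho> j \<le> 1 / 4" unfolding j_def by (rule LeastI_ex[OF ex])
  hence hi: "\<rho> n \<le> 1 / 4" if "n \<ge> j" for n using mono[OF that] by linarith
  \<comment> \<open>The case j = 0 is excluded as well: then the constant term dominates and the
    condition on earlier ratios is vacuous.\<close>
  have "\<exists>i. j = Suc i \<and> \<rho> i < 4"
  proof (rule ccontr)
    assume *: "\<not> ?thesis"
    have "\<rho> n \<ge> 4" if nj: "n < j" for n
    proof -
      obtain i where "j = Suc i" using nj less_imp_Suc_add by blast
      thus ?thesis using * mono[of n i] nj by auto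
    qed
    hence "fpt (- y) q \<noteq> 0"
      using hi unfolding \<rho>_def by (intro fpt_dominant_term[OF q y, where j = j]) auto
    thus False using zero by (simp add: y_def)
  qed
  then obtain i where i: "j = Suc i" "\<rho> i < 4" by blast
  hence "\<not> \<rho> i \<le> 1 / 4" using not_less_Least[of i "\<lambda>n. \<rho> n \<le> 1 / 4"] by (simp add: j_def)
  thus ?thesis using i q by (intro that[of "Suc i" "\<rho> i"]) (auto simp: \<rho>_def y_def)
qed

text \<open>All zeros have the form \<open>X n\<close>, and \<open>X\<close> is strictly decreasing,
  so exactly n - 1 zeros lie above \<open>X n\<close>. This is the count that singles out the k-th
  zero in \<open>xz\<close>.\<close>

lemma w_eq_zfix:
  assumes k: "k \<ge> 1" and q: "0 < q" "q \<le> q_radius"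
  shows "w k q = zfix k q"
proof -
  define X where "X n = - (real n * zfix n q / q ^ (n - 1))" for n
  have q': "norm q \<le> q_radius" "q \<le> 1" "q \<le> 1 / 1000" using q by (auto simp: q_radius_def)
  have z: "1 / 2 \<le> zfix n q" "zfix n q \<le> 3 / 2" if "n \<ge> 1" for n
    using zfix_cball[OF that q'(1)] unfolding mem_cball dist_real_def by linarith+
  have zeros: "fpt x q = 0 \<longleftrightarrow> x \<in> X ` {1..}" for x
  proof
    assume "fpt x q = 0"
    then obtain n v where nv: "n \<ge> 1" "1 / 4 < v" "v < 4" "x = - (real n * v / q ^ (n - 1))"
      using fpt_zero_location[OF q(1) q'(2)] by metis
    hence "v = zfix n q"
      using \<open>fpt x q = 0\<close> by (subst (asm) nv(4), subst (asm) fpt_zero_iff) (use q in \<open>auto simp: annulus_def\<close>)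
    thus "x \<in> X ` {1..}" using nv by (auto simp: X_def)
  next
    assume "x \<in> X ` {1..}"
    then obtain n where n: "n \<ge> 1" "x = X n" by auto
    have "zfix n q > 0" using z[OF n(1)] by simp
    thus "fpt x q = 0"
      unfolding n(2) X_def using fpt_zero_iff[OF n(1) q(1) _ q(2) zfix_annulus[OF n(1) q'(1)]] by simp
  qed
  \<comment> \<open>Since the fixed points lie between 1/2 and 3/2, the factor 1/q, at least 1000,
    outweighs their variation.\<close>
  have "strict_mono (\<lambda>i. - X (Suc i))"
    unfolding strict_mono_Suc_iff
  proof
    fix i
    have "real (Suc i) * zfix (Suc i) q * q \<le> real (Suc i) * (3 / 2) * (1 / 1000)"
      using z[of "Suc i"] q' q by (intro mult_mono) auto
    also have "\<dots> < real (Suc (Suc i)) * (1 / 2)" by simp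
    also have "\<dots> \<le> real (Suc (Suc i)) * zfix (Suc (Suc i)) q"
      using z[of "Suc (Suc i)"] by (intro mult_left_mono) auto
    finally have "real (Suc i) * zfix (Suc i) q < real (Suc (Suc i)) * zfix (Suc (Suc i)) q / q"
      using q by (simp add: pos_less_divide_eq del: of_nat_Suc)
    hence "real (Suc i) * zfix (Suc i) q / q ^ i < real (Suc (Suc i)) * zfix (Suc (Suc i)) q / q / q ^ i"
      using q by (intro divide_strict_right_mono) auto
    thus "- X (Suc i) < - X (Suc (Suc i))" by (simp add: X_def del: of_nat_Suc)
  qed
  hence less_iff: "X m < X n \<longleftrightarrow> n < m" if "n \<ge> 1" "m \<ge> 1" for m n
    using strict_mono_less[of "\<lambda>i. - X (Suc i)" "n - 1" "m - 1"] that by auto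
  have inj: "inj_on X {1..}"
    by (rule inj_onI) (metis less_iff atLeast_iff less_irrefl linorder_neqE_nat)
  have above: "{y. X n < y \<and> fpt y q = 0} = X ` {1..<n}" if "n \<ge> 1" for n
    unfolding zeros using less_iff that by auto
  have card: "card (X ` {1..<n}) = n - 1" if "n \<ge> 1" for n
    by (subst card_image) (auto intro: inj_on_subset[OF inj])
  have "xz k q = X k"
    unfolding xz_def
  proof (rule the_equality)
    show "fpt (X k) q = 0 \<and> finite {y. X k < y \<and> fpt y q = 0} \<and> card {y. X k < y \<and> fpt y q = 0} = k - 1"
      unfolding above[OF k] using card[OF k] zeros k by auto
  next
    fix x assume x: "fpt x q = 0 \<and> finite {y. x < y \<and> fpt y q = 0} \<and> card {y. x < y \<and> fpt y q = 0} = k - 1"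
    then obtain n where n: "n \<ge> 1" "x = X n" using zeros by auto
    hence "n - 1 = k - 1" using x above[OF n(1)] card[OF n(1)] by simp
    hence "n = k" using n k by linarith
    thus "x = X k" using n by simp
  qed
  thus ?thesis using k q by (simp add: w_def X_def)
qed

subsection \<open>Taylor coefficients\<close>

text \<open>Were the subdegree n of F at most N, then f(q)/q^n would tend to a nonzero coefficient,
  whereas the bound forces 0. A right neighbourhood suffices, which is where \<open>w\<close> is
  known.\<close>

lemma fps_dvd_of_small_on_right:
  fixes f :: "real \<Rightarrow> real"
  assumes F: "f has_fps_expansion F"
    and small: "eventually (\<lambda>q. \<bar>f q\<bar> \<le> C * q ^ Suc N) (at_right 0)"
  shows "fps_X ^ Suc N dvd F"
proof (rule ccontr)
  assume not_dvd: "\<not> fps_X ^ Suc N dvd F"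
  define n where "n = subdegree F"
  have n: "n \<le> N"
  proof -
    obtain m where "m < Suc N" "F $ m \<noteq> 0" using not_dvd unfolding fps_X_power_dvd_iff by blast
    thus ?thesis using subdegree_leI[of F m] by (simp add: n_def)
  qed
  have F_nz: "F \<noteq> 0" using not_dvd by auto
  define h where "h q = (if q = 0 then F $ n else f q / q ^ n)" for q
  have "h has_fps_expansion fps_shift n F"
    unfolding h_def using F by (intro has_fps_expansion_shift) (auto simp: n_def)
  hence "continuous (at 0 within {0<..}) h" by (rule has_fps_expansion_imp_continuous)
  hence lim: "(h \<longlongrightarrow> F $ n) (at_right 0)" by (simp add: continuous_within h_def)
  have "eventually (\<lambda>q. q < 1) (at_right (0 :: real))"
    unfolding eventually_at_right_field by (intro exI[of _ 1]) auto
  hence "eventually (\<lambda>q. norm (h q) \<le> \<bar>C\<bar> * q) (at_right 0)"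
    using small eventually_at_right_less[of 0]
  proof eventually_elim
    case (elim q)
    have "q ^ Suc N = q ^ n * q ^ (Suc N - n)" using n by (simp flip: power_add)
    also have "\<dots> \<le> q ^ n * q ^ 1"
      using elim n by (intro mult_left_mono power_decreasing) auto
    finally have le: "q ^ Suc N \<le> q ^ n * q" by simp
    have "\<bar>f q\<bar> \<le> \<bar>C\<bar> * q ^ Suc N"
      using elim by (intro order.trans[OF elim(2)] mult_right_mono) auto
    also have "\<dots> \<le> \<bar>C\<bar> * (q ^ n * q)" by (intro mult_left_mono le) auto
    finally show ?case using elim by (simp add: h_def abs_mult field_simps)
  qed
  moreover have "((\<lambda>q. \<bar>C\<bar> * q) \<longlongrightarrow> 0) (at_right 0)"
    by (auto intro!: tendsto_eq_intros)
  ultimately have "(h \<longlongrightarrow> 0) (at_right 0)" by (rule Lim_null_comparison)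
  with lim have "F $ n = 0" using tendsto_unique[OF trivial_limit_at_right_real] by blast
  thus False using F_nz by (simp add: n_def)
qed

lemma has_fps_expansion_power:
  fixes F :: "real fps"
  shows "f has_fps_expansion F \<Longrightarrow> (\<lambda>x. f x ^ n) has_fps_expansion F ^ n"
  by (induction n) (auto intro!: fps_expansion_intros)

lemma minus_one_power_fps: "(-1) ^ l = fps_const ((-1 :: real) ^ l)"
  by (metis fps_const_1_eq_1 fps_const_neg fps_const_power)

lemma zero_eq_fps_expansion:
  assumes g: "g has_fps_expansion F" and F0: "F $ 0 = 1"
  shows "(\<lambda>q. \<Sum>l\<le>N. zterm k l q (g q)) has_fps_expansion zero_eq_fps k N F"
  unfolding zterm_def zero_eq_fps_def minus_one_power_fps of_real_eq_id id_apply
  using F0 by (intro fps_expansion_intros has_fps_expansion_power g) auto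

text \<open>At the fixed point the full series is 0, so the partial sum is minus a tail with
  geometric bound.\<close>

lemma zterm_partial_sum_bound:
  assumes k: "k \<ge> 1" and q: "0 < q" "q \<le> q_radius"
  shows "\<bar>\<Sum>l\<le>N. zterm k l q (zfix k q)\<bar> \<le> 10 * 4 ^ Suc N * q ^ Suc N"
proof -
  let ?z = "\<lambda>l. zterm k l q (zfix k q)"
  have q': "norm q \<le> q_radius" "norm q \<le> 1" "4 * q < 1" using q by (auto simp: q_radius_def)
  note ann = zfix_annulus[OF k q'(1)]
  have s: "(\<lambda>l. 5 * (4 * q) ^ Suc N * (4 * q) ^ l) sums (5 * (4 * q) ^ Suc N * (1 / (1 - 4 * q)))"
    using q q' by (intro sums_mult geometric_sums) auto
  have "0 = (\<Sum>l. ?z l)" using zmap_eq[OF k q'(1) ann] zfix_eq[OF k q'(1)] by simp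
  also have "\<dots> = (\<Sum>l. ?z (l + Suc N)) + (\<Sum>l<Suc N. ?z l)"
    by (rule suminf_split_initial_segment[OF zterm_summable[OF k q'(1) ann]])
  finally have "\<bar>\<Sum>l\<le>N. ?z l\<bar> = norm (\<Sum>l. ?z (l + Suc N))"
    by (simp add: lessThan_Suc_atMost)
  also have "\<dots> \<le> (\<Sum>l. 5 * (4 * q) ^ Suc N * (4 * q) ^ l)"
  proof (intro norm_suminf_le sums_summable[OF s])
    fix l
    show "norm (?z (l + Suc N)) \<le> 5 * (4 * q) ^ Suc N * (4 * q) ^ l"
      using zterm_bound[OF k q'(2) ann, of "l + Suc N"] q unfolding power_add by (simp add: mult_ac)
  qed
  also have "\<dots> = 5 * (4 * q) ^ Suc N * (1 / (1 - 4 * q))" using s by (simp add: sums_iff)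
  also have "\<dots> \<le> 5 * (4 * q) ^ Suc N * 2"
    using q by (intro mult_left_mono) (auto simp: q_radius_def field_simps)
  finally show ?thesis by (simp add: power_mult_distrib mult_ac)
qed

lemma has_fps_expansion_of_sums_right:
  assumes "r > 0" "\<forall>q. 0 < q \<and> q < r \<longrightarrow> (\<lambda>n. c n * q ^ n) sums h q"
  shows "eval_fps (Abs_fps c) has_fps_expansion Abs_fps c"
    and "eventually (\<lambda>q. eval_fps (Abs_fps c) q = h q) (at_right (0 :: real))"
proof -
  have "fps_conv_radius (Abs_fps c) \<ge> norm (r / 2)"
    unfolding fps_conv_radius_def
    using assms(2)[rule_format, of "r / 2"] assms(1) by (intro conv_radius_geI) (auto simp: sums_iff)
  moreover have "ereal (norm (r / 2)) > 0" using assms(1) by simp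
  ultimately show "eval_fps (Abs_fps c) has_fps_expansion Abs_fps c"
    by (intro eval_fps_has_fps_expansion) (meson less_le_trans)
  show "eventually (\<lambda>q. eval_fps (Abs_fps c) q = h q) (at_right (0 :: real))"
    unfolding eventually_at_right_field
    using assms by (intro exI[of _ r]) (auto simp: eval_fps_def sums_iff)
qed

text \<open>The Taylor coefficients of the holomorphic fixed point are a witness for the choice in
  \<open>wcoef\<close>.\<close>

lemma wcoef_sums:
  assumes "k \<ge> 1"
  obtains r where "r > 0" "\<forall>q. 0 < q \<and> q < r \<longrightarrow> (\<lambda>n. wcoef k n * q ^ n) sums w k q"
proof -
  have "\<forall>q. 0 < q \<and> q < q_radius \<longrightarrow> zfix k (complex_of_real q) = complex_of_real (w k q)"
    using assms by (simp add: w_eq_zfix zfix_of_real)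
  then obtain c where "\<forall>q. 0 < q \<and> q < q_radius \<longrightarrow> (\<lambda>n. c n * q ^ n) sums w k q"
    using real_power_series_of_holomorphic[OF holomorphic_zfix[OF assms], of "w k"] by blast
  hence "\<exists>c. \<exists>r>0. r \<le> 1 \<and> (\<forall>q. 0 < q \<and> q < r \<longrightarrow> (\<lambda>n. c n * q ^ n) sums w k q)"
    by (intro exI[of _ c] exI[of _ q_radius]) (auto simp: q_radius_def)
  from someI_ex[OF this] show ?thesis
    using that unfolding wcoef_def[symmetric] by blast
qed

lemma winvcoef_sums:
  assumes "k \<ge> 1"
  obtains r where "r > 0" "\<forall>q. 0 < q \<and> q < r \<longrightarrow> (\<lambda>n. winvcoef k n * q ^ n) sums (1 / w k q)"
proof -
  have "zfix k q \<noteq> 0" if "q \<in> ball 0 q_radius" for q :: complex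
    using zfix_annulus[OF assms, of q] that annulus_nonzero by auto
  hence hol: "(\<lambda>q :: complex. 1 / zfix k q) holomorphic_on ball 0 q_radius"
    by (intro holomorphic_intros holomorphic_zfix assms)
  have "\<forall>q. 0 < q \<and> q < q_radius \<longrightarrow> 1 / zfix k (complex_of_real q) = complex_of_real (1 / w k q)"
    using assms by (simp add: w_eq_zfix zfix_of_real)
  then obtain c where "\<forall>q. 0 < q \<and> q < q_radius \<longrightarrow> (\<lambda>n. c n * q ^ n) sums (1 / w k q)"
    using real_power_series_of_holomorphic[OF hol, of "\<lambda>q. 1 / w k q"] by blast
  hence "\<exists>c. \<exists>r>0. r \<le> 1 \<and> (\<forall>q. 0 < q \<and> q < r \<longrightarrow> (\<lambda>n. c n * q ^ n) sums (1 / w k q))"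
    by (intro exI[of _ c] exI[of _ q_radius]) (auto simp: q_radius_def)
  from someI_ex[OF this] show ?thesis
    using that unfolding winvcoef_def[symmetric] by blast
qed

definition wfps :: "nat \<Rightarrow> real fps" where "wfps k = Abs_fps (wcoef k)"

lemma wfps_expansion:
  assumes "k \<ge> 1"
  shows "eval_fps (wfps k) has_fps_expansion wfps k"
    and "eventually (\<lambda>q. eval_fps (wfps k) q = zfix k q \<and> 0 < q \<and> q \<le> q_radius) (at_right 0)"
proof -
  obtain r where "r > 0" "\<forall>q. 0 < q \<and> q < r \<longrightarrow> (\<lambda>n. wcoef k n * q ^ n) sums w k q"
    using wcoef_sums[OF assms] by blast
  note * = has_fps_expansion_of_sums_right[OF this]
  show "eval_fps (wfps k) has_fps_expansion wfps k" using *(1) by (simp add: wfps_def)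
  have "eventually (\<lambda>q. 0 < q \<and> q \<le> q_radius) (at_right 0)"
    unfolding eventually_at_right_field using q_radius_pos by (intro exI[of _ q_radius]) auto
  with *(2) show "eventually (\<lambda>q. eval_fps (wfps k) q = zfix k q \<and> 0 < q \<and> q \<le> q_radius) (at_right 0)"
    by eventually_elim (use assms in \<open>auto simp: wfps_def w_eq_zfix\<close>)
qed

lemma wfps_nth_0:
  assumes k: "k \<ge> 1"
  shows "wfps k $ 0 = 1"
proof -
  have "(\<lambda>q. eval_fps (wfps k) q - 1) has_fps_expansion (wfps k - 1)"
    by (intro fps_expansion_intros wfps_expansion k)
  \<comment> \<open>The case N = 0 of the partial sum bound; 40 is 10 times 4.\<close>
  moreover have "eventually (\<lambda>q. \<bar>eval_fps (wfps k) q - 1\<bar> \<le> 40 * q ^ Suc 0) (at_right 0)"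
    using wfps_expansion(2)[OF k]
  proof eventually_elim
    case (elim q)
    have "zterm k 0 q (zfix k q) = zfix k q - 1" by (simp add: zterm_def)
    thus ?case using zterm_partial_sum_bound[OF k, of q 0] elim by simp
  qed
  ultimately have "fps_X ^ Suc 0 dvd wfps k - 1" by (rule fps_dvd_of_small_on_right)
  thus ?thesis unfolding fps_X_power_dvd_iff by simp
qed

lemma wfps_equation:
  assumes k: "k \<ge> 1"
  shows "fps_X ^ Suc N dvd zero_eq_fps k N (wfps k)"
proof (rule fps_dvd_of_small_on_right)
  show "(\<lambda>q. \<Sum>l\<le>N. zterm k l q (eval_fps (wfps k) q)) has_fps_expansion zero_eq_fps k N (wfps k)"
    by (intro zero_eq_fps_expansion wfps_expansion wfps_nth_0 k)
  show "eventually (\<lambda>q. \<bar>\<Sum>l\<le>N. zterm k l q (eval_fps (wfps k) q)\<bar> \<le> 10 * 4 ^ Suc N * q ^ Suc N) (at_right 0)"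
    using wfps_expansion(2)[OF k]
    by eventually_elim (use zterm_partial_sum_bound[OF k] in auto)
qed

text \<open>The two series have product 1 on a right neighbourhood of 0, so the formal product
  differs from 1 by something divisible by every power of q.\<close>

lemma winvcoef_eq:
  assumes k: "k \<ge> 1"
  shows "winvcoef k n = inverse (wfps k) $ n"
proof -
  define V where "V = Abs_fps (winvcoef k)"
  obtain r where "r > 0" "\<forall>q. 0 < q \<and> q < r \<longrightarrow> (\<lambda>n. winvcoef k n * q ^ n) sums (1 / w k q)"
    using winvcoef_sums[OF k] by blast
  note * = has_fps_expansion_of_sums_right[OF this, folded V_def]
  have "fps_X ^ Suc N dvd V * wfps k - 1" for N
  proof (rule fps_dvd_of_small_on_right)
    show "(\<lambda>q. eval_fps V q * eval_fps (wfps k) q - 1) has_fps_expansion (V * wfps k - 1)"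
      by (intro fps_expansion_intros wfps_expansion k *)
    show "eventually (\<lambda>q. \<bar>eval_fps V q * eval_fps (wfps k) q - 1\<bar> \<le> 0 * q ^ Suc N) (at_right 0)"
      using *(2) wfps_expansion(2)[OF k]
    proof eventually_elim
      case (elim q)
      hence "zfix k q \<noteq> 0" using zfix_annulus[OF k, of q] annulus_nonzero by auto
      thus ?case using elim w_eq_zfix[OF k, of q] by simp
    qed
  qed
  hence "V * wfps k = 1"
    unfolding fps_X_power_dvd_iff by (intro fps_ext) (metis fps_sub_nth lessI right_minus_eq)
  hence "V = inverse (wfps k)"
    using fps_inverse_unique[of "wfps k" V] by (simp add: mult.commute)
  moreover have "V $ n = winvcoef k n" by (simp add: V_def)
  ultimately show ?thesis by simp
qed

subsection \<open>Asymptotics for large \<open>k\<close>\<close>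

lemma ratio_bigo_1: "(\<lambda>k. real k / (real k + real s)) \<in> O(\<lambda>k. 1)"
  by (rule bigoI[of _ 1]) (auto intro!: always_eventually simp: divide_le_eq_1)

lemma inverse_power_bigo_mono: "i \<le> j \<Longrightarrow> (\<lambda>k. 1 / real k ^ j) \<in> O(\<lambda>k. 1 / real k ^ i)"
  by (rule bigoI[of _ 1], rule eventually_mono[OF eventually_gt_at_top[of 0]])
     (auto intro!: divide_left_mono power_increasing)

lemma cmult_bigo: "f \<in> O(g) \<Longrightarrow> (\<lambda>k. c * f k) \<in> O(g)" for f g :: "nat \<Rightarrow> real"
  by (cases "c = 0") auto

lemma cmult_inverse_power_bigo: "i \<le> j \<Longrightarrow> (\<lambda>k. c * (1 / real k ^ j)) \<in> O(\<lambda>k. 1 / real k ^ i)"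
  by (rule cmult_bigo) (rule inverse_power_bigo_mono)

text \<open>The complete (\<open>c = 1\<close>) and elementary (\<open>c = -1\<close>) symmetric functions of \<open>1, \<dots>, l\<close> of degrees
  2 and 3 in terms of the power sums \<open>p\<^sub>1 = t\<close>, \<open>p\<^sub>2 = (2 l + 1) t / 3\<close>, \<open>p\<^sub>3 = t\<^sup>2\<close>, with \<open>t\<close> the \<open>l\<close>-th
  triangular number.\<close>

definition sym2 :: "real \<Rightarrow> nat \<Rightarrow> real" where
  "sym2 c l = (let t = real (tri l) in (t ^ 2 + c * ((2 * real l + 1) * t / 3)) / 2)"

definition sym3 :: "real \<Rightarrow> nat \<Rightarrow> real" where
  "sym3 c l = (let t = real (tri l) in (t ^ 3 + 3 * c * t * ((2 * real l + 1) * t / 3) + 2 * t ^ 2) / 6)"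

text \<open>The expansion up to e^3 of the product of 1/(1 + i e) for c = 1, or of 1 - i e for c =
  -1, over i = 1, ..., l. With e = 1/k these products are \<open>upper_coeff\<close> and
  \<open>lower_coeff\<close>.\<close>

definition symexp :: "real \<Rightarrow> nat \<Rightarrow> real \<Rightarrow> real" where
  "symexp c l e = 1 - real (tri l) * e + sym2 c l * e ^ 2 - sym3 c l * e ^ 3"

lemma symexp_0 [simp]: "symexp c 0 e = 1"
  by (simp add: symexp_def sym2_def sym3_def)

text \<open>The recursion h_j(1..l+1) = h_j(1..l) + (l+1) h_(j-1)(1..l+1) matches all orders up to
  e^3; the cut leaves one term in e^4.\<close>

lemma symexp_complete_Suc:
  "symexp 1 (Suc l) e * (1 + real (Suc l) * e) = symexp 1 l e - real (Suc l) * sym3 1 (Suc l) * e ^ 4"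
  unfolding symexp_def sym2_def sym3_def Let_def real_tri
  by (simp add: field_simps power2_eq_square power3_eq_cube power4_eq_xxxx)

lemma symexp_elementary_Suc:
  "symexp (-1) l e * (1 - real (Suc l) * e) = symexp (-1) (Suc l) e + real (Suc l) * sym3 (-1) l * e ^ 4"
  unfolding symexp_def sym2_def sym3_def Let_def real_tri
  by (simp add: field_simps power2_eq_square power3_eq_cube power4_eq_xxxx)

lemma upper_coeff_expansion: "(\<lambda>k. upper_coeff k l - symexp 1 l (1 / real k)) \<in> O(\<lambda>k. 1 / real k ^ 4)"
proof (induction l)
  case (Suc l)
  let ?s = "real (Suc l)"
  have "(\<lambda>k. ((upper_coeff k l - symexp 1 l (1 / real k)) + ?s * sym3 1 (Suc l) * (1 / real k ^ 4)) * (real k / (real k + ?s)))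
          \<in> O(\<lambda>k. 1 / real k ^ 4 * 1)"
    by (intro landau_o.big.mult sum_in_bigo(1) Suc ratio_bigo_1 cmult_inverse_power_bigo order.refl)
  also have "?this \<longleftrightarrow> (\<lambda>k. upper_coeff k (Suc l) - symexp 1 (Suc l) (1 / real k)) \<in> O(\<lambda>k. 1 / real k ^ 4)"
  proof (intro landau_o.big.cong_ex eventually_mono[OF eventually_gt_at_top[of "0::nat"]])
    fix k :: nat assume k: "k > 0"
    have "1 + ?s * (1 / real k) = (real k + ?s) / real k" "real k + ?s > 0"
      using k by (simp_all add: add_divide_distrib del: of_nat_Suc)
    hence r: "(1 + ?s * (1 / real k)) * (real k / (real k + ?s)) = 1"
      using k by (simp del: of_nat_Suc)
    have "symexp 1 (Suc l) (1 / real k)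
        = symexp 1 (Suc l) (1 / real k) * ((1 + ?s * (1 / real k)) * (real k / (real k + ?s)))"
      by (simp only: r mult_1_right)
    also have "\<dots> = (symexp 1 l (1 / real k) - ?s * sym3 1 (Suc l) * (1 / real k) ^ 4) * (real k / (real k + ?s))"
      by (simp only: mult.assoc[symmetric] symexp_complete_Suc)
    finally show "((upper_coeff k l - symexp 1 l (1 / real k)) + ?s * sym3 1 (Suc l) * (1 / real k ^ 4)) * (real k / (real k + ?s))
        = upper_coeff k (Suc l) - symexp 1 (Suc l) (1 / real k)"
      by (simp only: upper_coeff_Suc power_one_over) (simp only: algebra_simps)
  qed simp
  finally show ?case .
qed simp

lemma lower_coeff_expansion: "(\<lambda>k. lower_coeff k l - symexp (-1) l (1 / real k)) \<in> O(\<lambda>k. 1 / real k ^ 4)"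
proof (induction l)
  case (Suc l)
  let ?s = "real (Suc l)"
  have "(\<lambda>k. ?s * (1 / real k ^ 1)) \<in> O(\<lambda>k. 1)"
    using cmult_inverse_power_bigo[of 0 1 ?s] by (simp only: power_0 div_by_1)
  hence "(\<lambda>k. 1 - ?s * (1 / real k ^ 1)) \<in> O(\<lambda>k. 1)"
    by (rule sum_in_bigo(2)[rotated]) simp
  from landau_o.big.mult[OF Suc this] have "(\<lambda>k. (lower_coeff k l - symexp (-1) l (1 / real k)) * (1 - ?s * (1 / real k ^ 1)) + ?s * sym3 (-1) l * (1 / real k ^ 4))
          \<in> O(\<lambda>k. 1 / real k ^ 4)"
    unfolding mult_1_right by (rule sum_in_bigo(1)) (intro cmult_inverse_power_bigo order.refl)
  also have "?this \<longleftrightarrow> (\<lambda>k. lower_coeff k (Suc l) - symexp (-1) (Suc l) (1 / real k)) \<in> O(\<lambda>k. 1 / real k ^ 4)"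
  proof (intro landau_o.big.cong_ex eventually_mono[OF eventually_gt_at_top[of "0::nat"]])
    fix k :: nat assume k: "k > 0"
    have "(real k - ?s) / real k = 1 - ?s * (1 / real k)" using k by (simp add: field_simps)
    thus "(lower_coeff k l - symexp (-1) l (1 / real k)) * (1 - ?s * (1 / real k ^ 1)) + ?s * sym3 (-1) l * (1 / real k ^ 4)
        = lower_coeff k (Suc l) - symexp (-1) (Suc l) (1 / real k)"
      using symexp_elementary_Suc[of l "1 / real k"]
      by (simp only: lower_coeff_Suc power_one_over power_one_right left_diff_distrib)
  qed simp
  finally show ?case .
qed simp

lemma upper_coeff_bigo_1: "(\<lambda>k. upper_coeff k l) \<in> O(\<lambda>k. 1)"
  using upper_coeff_nonneg upper_coeff_le_1 by (intro bigoI[of _ 1]) auto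

lemma lower_coeff_bigo_1: "(\<lambda>k. lower_coeff k l) \<in> O(\<lambda>k. 1)"
  by (rule bigoI[of _ 1], rule eventually_mono[OF eventually_gt_at_top[of 0]]) (auto simp: lower_coeff_abs_le_1)

text \<open>Complete and elementary symmetric functions agree in degree 1; they differ by p_2 in
  degree 2 and by p_1 p_2 in degree 3.\<close>

lemma upper_coeff_diff_lower_coeff:
  "(\<lambda>k. upper_coeff k l - lower_coeff k l - ((2 * real l + 1) * real (tri l) / 3 * (1 / real k ^ 2)
       - (2 * real l + 1) * real (tri l) ^ 2 / 3 * (1 / real k ^ 3))) \<in> O(\<lambda>k. 1 / real k ^ 4)"
proof -
  have "(\<lambda>k. (upper_coeff k l - symexp 1 l (1 / real k)) - (lower_coeff k l - symexp (-1) l (1 / real k))) \<in> O(\<lambda>k. 1 / real k ^ 4)"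
    by (intro sum_in_bigo(2) upper_coeff_expansion lower_coeff_expansion)
  moreover have "symexp 1 l e - symexp (-1) l e
      = (2 * real l + 1) * real (tri l) / 3 * e ^ 2 - (2 * real l + 1) * real (tri l) ^ 2 / 3 * e ^ 3" for e
    unfolding symexp_def sym2_def sym3_def Let_def by (simp add: field_simps power2_eq_square)
  hence "(upper_coeff k l - symexp 1 l (1 / real k)) - (lower_coeff k l - symexp (-1) l (1 / real k)) =
      upper_coeff k l - lower_coeff k l - ((2 * real l + 1) * real (tri l) / 3 * (1 / real k ^ 2)
       - (2 * real l + 1) * real (tri l) ^ 2 / 3 * (1 / real k ^ 3))" for k
  proof -
    assume *: "\<And>e. symexp 1 l e - symexp (-1) l e
      = (2 * real l + 1) * real (tri l) / 3 * e ^ 2 - (2 * real l + 1) * real (tri l) ^ 2 / 3 * e ^ 3"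
    have "(upper_coeff k l - symexp 1 l (1 / real k)) - (lower_coeff k l - symexp (-1) l (1 / real k))
      = upper_coeff k l - lower_coeff k l - (symexp 1 l (1 / real k) - symexp (-1) l (1 / real k))" by simp
    thus ?thesis by (simp only: * power_one_over)
  qed
  ultimately show ?thesis by (simp only:)
qed

lemma symexp_linear: "(\<lambda>k. symexp c l (1 / real k) - (1 - real (tri l) * (1 / real k))) \<in> O(\<lambda>k. 1 / real k ^ 2)"
proof -
  have "(\<lambda>k. sym2 c l * (1 / real k ^ 2) - sym3 c l * (1 / real k ^ 3)) \<in> O(\<lambda>k. 1 / real k ^ 2)"
    by (intro sum_in_bigo(2) cmult_inverse_power_bigo) auto
  thus ?thesis by (simp add: symexp_def power_one_over)
qed

text \<open>This is the factor of w - 1 in the linearised equation. As w - 1 is itself O(k^-2), an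
  error O(k^-2) here is precise enough.\<close>

lemma upper_coeff_lower_coeff_weighted:
  "(\<lambda>k. (real l + 1) * upper_coeff k l + real l * lower_coeff k l - (2 * real l + 1) * (1 - real (tri l) * (1 / real k)))
     \<in> O(\<lambda>k. 1 / real k ^ 2)"
proof -
  have mono: "f \<in> O(\<lambda>k. 1 / real k ^ 4) \<Longrightarrow> f \<in> O(\<lambda>k. 1 / real k ^ 2)" for f
    using landau_o.big.trans[OF _ inverse_power_bigo_mono[of 2 4]] by simp
  have "(\<lambda>k. (upper_coeff k l - symexp 1 l (1 / real k)) + (symexp 1 l (1 / real k) - (1 - real (tri l) * (1 / real k)))) \<in> O(\<lambda>k. 1 / real k ^ 2)"
    by (intro sum_in_bigo(1) mono upper_coeff_expansion symexp_linear)
  moreover have "(\<lambda>k. (lower_coeff k l - symexp (-1) l (1 / real k)) + (symexp (-1) l (1 / real k) - (1 - real (tri l) * (1 / real k)))) \<in> O(\<lambda>k. 1 / real k ^ 2)"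
    by (intro sum_in_bigo(1) mono lower_coeff_expansion symexp_linear)
  moreover have "(x - y) + (y - z) = x - z" for x y z :: real by simp
  ultimately have "(\<lambda>k. (real l + 1) * (upper_coeff k l - (1 - real (tri l) * (1 / real k))) + real l * (lower_coeff k l - (1 - real (tri l) * (1 / real k)))) \<in> O(\<lambda>k. 1 / real k ^ 2)"
    by (intro sum_in_bigo(1) cmult_bigo) (simp_all only:)
  moreover have "(real l + 1) * (x - (1 - t)) + real l * (y - (1 - t))
      = (real l + 1) * x + real l * y - (2 * real l + 1) * (1 - t)" for x y t :: real
    by (simp add: algebra_simps)
  ultimately show ?thesis by (simp only:)
qed

section \<open>Families of power series with coefficients of given order in 1/k\<close>

definition fam_bigo :: "nat \<Rightarrow> nat \<Rightarrow> (nat \<Rightarrow> real fps) \<Rightarrow> bool" where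
  "fam_bigo N j g \<longleftrightarrow> (\<forall>m\<le>N. (\<lambda>k. g k $ m) \<in> O(\<lambda>k. 1 / real k ^ j))"

lemma fam_bigo_cong:
  assumes "\<And>k. k \<ge> 1 \<Longrightarrow> f k = g k" "fam_bigo N j f"
  shows "fam_bigo N j g"
proof -
  have "(\<lambda>k. f k $ m) \<in> O(\<lambda>k. 1 / real k ^ j) \<longleftrightarrow> (\<lambda>k. g k $ m) \<in> O(\<lambda>k. 1 / real k ^ j)" for m
    by (intro landau_o.big.in_cong eventually_mono[OF eventually_ge_at_top[of 1]]) (simp add: assms(1))
  thus ?thesis using assms(2) by (simp add: fam_bigo_def)
qed

lemma fam_bigo_add: "fam_bigo N j f \<Longrightarrow> fam_bigo N j g \<Longrightarrow> fam_bigo N j (\<lambda>k. f k + g k)"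
  by (auto simp: fam_bigo_def intro: sum_in_bigo)

lemma fam_bigo_diff: "fam_bigo N j f \<Longrightarrow> fam_bigo N j g \<Longrightarrow> fam_bigo N j (\<lambda>k. f k - g k)"
  by (auto simp: fam_bigo_def intro: sum_in_bigo)

lemma fam_bigo_sum: "(\<And>x. x \<in> S \<Longrightarrow> fam_bigo N j (f x)) \<Longrightarrow> fam_bigo N j (\<lambda>k. \<Sum>x\<in>S. f x k)"
  by (auto simp: fam_bigo_def fps_sum_nth intro: big_sum_in_bigo)

lemma fam_bigo_mult:
  assumes "fam_bigo N i f" "fam_bigo N j g"
  shows "fam_bigo N (i + j) (\<lambda>k. f k * g k)"
  unfolding fam_bigo_def fps_mult_nth
proof (intro allI impI big_sum_in_bigo)
  fix m l assume "m \<le> N" "l \<in> {0..m}"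
  hence "(\<lambda>k. f k $ l * g k $ (m - l)) \<in> O(\<lambda>k. 1 / real k ^ i * (1 / real k ^ j))"
    using assms unfolding fam_bigo_def by (intro landau_o.big.mult) auto
  thus "(\<lambda>k. f k $ l * g k $ (m - l)) \<in> O(\<lambda>k. 1 / real k ^ (i + j))"
    by (simp add: power_add)
qed

lemma fam_bigo_mono: "fam_bigo N j f \<Longrightarrow> i \<le> j \<Longrightarrow> fam_bigo N i f"
  unfolding fam_bigo_def using landau_o.big.trans[OF _ inverse_power_bigo_mono] by blast

lemma fam_bigo_mult_0: "fam_bigo N 0 f \<Longrightarrow> fam_bigo N j g \<Longrightarrow> fam_bigo N j (\<lambda>k. f k * g k)"
  using fam_bigo_mult[of N 0 f j g] by simp

lemma fam_bigo_const: "fam_bigo N 0 (\<lambda>_. f)"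
  by (simp add: fam_bigo_def)

lemma fam_bigo_fps_const:
  assumes "c \<in> O(\<lambda>k. 1 / real k ^ j)"
  shows "fam_bigo N j (\<lambda>k. fps_const (c k))"
proof -
  have "(\<lambda>k. fps_const (c k) $ m) \<in> O(\<lambda>k. 1 / real k ^ j)" for m
    using assms by (cases "m = 0") simp_all
  thus ?thesis by (simp add: fam_bigo_def)
qed

lemma fam_bigo_power: "fam_bigo N 0 f \<Longrightarrow> fam_bigo N 0 (\<lambda>k. f k ^ n)"
  by (induction n) (auto intro: fam_bigo_const fam_bigo_mult_0)

lemma fam_bigo_dvd:
  assumes "\<And>k. k \<ge> 1 \<Longrightarrow> fps_X ^ Suc N dvd f k"
  shows "fam_bigo N j f"
proof -
  have "(\<lambda>k. f k $ m) \<in> O(\<lambda>k. 1 / real k ^ j)" if "m \<le> N" for m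
  proof -
    have "(\<lambda>k. f k $ m) \<in> O(\<lambda>k. 1 / real k ^ j) \<longleftrightarrow> (\<lambda>k. 0) \<in> O(\<lambda>k. 1 / real k ^ j)"
      using that assms unfolding fps_X_power_dvd_iff
      by (intro landau_o.big.in_cong eventually_mono[OF eventually_ge_at_top[of 1]]) auto
    thus ?thesis by simp
  qed
  thus ?thesis by (simp add: fam_bigo_def)
qed

text \<open>Induction on (1+g)^(n+1) - 1 - (n+1) g = (1+g) ((1+g)^n - 1 - n g) + n g^2.\<close>

lemma fam_bigo_power_linear:
  assumes "fam_bigo N 2 g"
  shows "fam_bigo N 4 (\<lambda>k. (1 + g k) ^ n - 1 - of_nat n * g k)"
proof (induction n)
  case (Suc n)
  have "fam_bigo N 0 (\<lambda>k. 1 + g k)"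
    using assms by (intro fam_bigo_add fam_bigo_const) (rule fam_bigo_mono, auto)
  hence "fam_bigo N 4 (\<lambda>k. (1 + g k) * ((1 + g k) ^ n - 1 - of_nat n * g k))"
    by (rule fam_bigo_mult_0) (rule Suc)
  moreover have "fam_bigo N 4 (\<lambda>k. of_nat n * (g k * g k))"
    using fam_bigo_mult[OF assms assms] by (intro fam_bigo_mult_0[OF fam_bigo_const]) simp
  ultimately have "fam_bigo N 4 (\<lambda>k. (1 + g k) * ((1 + g k) ^ n - 1 - of_nat n * g k) + of_nat n * (g k * g k))"
    by (rule fam_bigo_add)
  thus ?case by (simp add: algebra_simps)
qed (simp add: fam_bigo_def)

text \<open>With a property independent of the grade, the recursion behind \<open>solution\<close>
  shows that each coefficient of w is bounded in k.\<close>

interpretation bounded: graded_family "\<lambda>_ c. c \<in> O(\<lambda>k. 1)"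
proof
  fix c d :: "nat \<Rightarrow> real"
  assume "\<And>k. k \<ge> 1 \<Longrightarrow> c k = d k" "c \<in> O(\<lambda>k. 1)"
  moreover from this have "c \<in> O(\<lambda>k. 1) \<longleftrightarrow> d \<in> O(\<lambda>k. 1)"
    by (intro landau_o.big.in_cong eventually_mono[OF eventually_ge_at_top[of 1]]) simp
  ultimately show "d \<in> O(\<lambda>k. 1)" by simp
next
  fix c d :: "nat \<Rightarrow> real"
  assume "c \<in> O(\<lambda>k. 1)" "d \<in> O(\<lambda>k. 1)"
  thus "(\<lambda>k. c k * d k) \<in> O(\<lambda>k. 1)" using landau_o.big.mult[of c sequentially "\<lambda>_. 1" d "\<lambda>_. 1"] by simp
qed (auto intro: sum_in_bigo upper_coeff_bigo_1 lower_coeff_bigo_1)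

lemma bounded_fam: "bounded.fam N f \<longleftrightarrow> fam_bigo N 0 f"
  by (simp add: bounded.fam_def fam_bigo_def)

lemma wfps_bounded: "fam_bigo N 0 wfps"
  using bounded.solution[OF wfps_nth_0 wfps_equation] by (simp add: bounded_fam)

lemma inverse_bounded: "fam_bigo N 0 f \<Longrightarrow> (\<And>k. k \<ge> 1 \<Longrightarrow> f k $ 0 = 1) \<Longrightarrow> fam_bigo N 0 (\<lambda>k. inverse (f k))"
  using bounded.fam_inverse by (simp add: bounded_fam)

definition wfps_dev :: "nat \<Rightarrow> real fps" where "wfps_dev k = wfps k - 1"

lemma wfps_inverse: "k \<ge> 1 \<Longrightarrow> wfps k * inverse (wfps k) = 1"
  by (simp add: inverse_mult_eq_1' wfps_nth_0)

definition theta_term :: "nat \<Rightarrow> real fps" where "theta_term l = (-1) ^ l * fps_X ^ tri l"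

lemma zero_eq_fps_theta_term:
  "zero_eq_fps k N F = (\<Sum>l\<le>N. theta_term l * (fps_const (upper_coeff k l) * F ^ (l + 1) - fps_const (lower_coeff k l) * inverse F ^ l))"
  by (simp add: zero_eq_fps_def theta_term_def)

lemma upper_coeff_fam: "fam_bigo N 0 (\<lambda>k. fps_const (upper_coeff k l))" and lower_coeff_fam: "fam_bigo N 0 (\<lambda>k. fps_const (lower_coeff k l))"
  using upper_coeff_bigo_1 lower_coeff_bigo_1 by (auto intro!: fam_bigo_fps_const)

text \<open>Factoring \<open>W - 1\<close> out of the equation leaves a bounded family with constant term 1, hence with
  bounded inverse, against \<open>\<Sum> \<plusminus>(A\<^sub>l - B\<^sub>l) q\<^bsup>l(l+1)/2\<^esup> = O(k\<^sup>-\<^sup>2)\<close>.\<close>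

lemma wfps_dev_bigo: "fam_bigo N 2 wfps_dev"
proof -
  define V where "V k = inverse (wfps k)" for k
  define G where "G k l = fps_const (upper_coeff k l) * (\<Sum>i<l + 1. wfps k ^ i) + fps_const (lower_coeff k l) * (V k * (\<Sum>i<l. V k ^ i))" for k l
  define H where "H k = (\<Sum>l\<le>N. theta_term l * G k l)" for k
  define S where "S k = (\<Sum>l\<le>N. theta_term l * fps_const (upper_coeff k l - lower_coeff k l))" for k
  have V: "fam_bigo N 0 V" unfolding V_def by (intro inverse_bounded wfps_bounded wfps_nth_0)
  have H: "fam_bigo N 0 H"
    unfolding H_def G_def
    by (intro fam_bigo_sum fam_bigo_mult_0 fam_bigo_add fam_bigo_const upper_coeff_fam lower_coeff_fam fam_bigo_power V wfps_bounded)
  have H0: "H k $ 0 = 1" if "k \<ge> 1" for k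
  proof -
    \<comment> \<open>For l = 0 the first geometric sum in \<open>G\<close> is 1 and the second is
      empty; for other l the power of q is positive.\<close>
    have "(theta_term l * G k l) $ 0 = (if l = 0 then 1 else 0)" for l
      using le_tri[of l] by (auto simp: theta_term_def G_def mult.assoc fps_X_power_mult_nth)
    thus ?thesis by (simp add: H_def fps_sum_nth)
  qed
  have "fam_bigo N 2 S"
    unfolding S_def
  proof (intro fam_bigo_sum fam_bigo_mult_0[OF fam_bigo_const] fam_bigo_fps_const)
    fix l
    have "(\<lambda>k. (upper_coeff k l - lower_coeff k l - ((2 * real l + 1) * real (tri l) / 3 * (1 / real k ^ 2)
       - (2 * real l + 1) * real (tri l) ^ 2 / 3 * (1 / real k ^ 3))) +
       ((2 * real l + 1) * real (tri l) / 3 * (1 / real k ^ 2)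
       - (2 * real l + 1) * real (tri l) ^ 2 / 3 * (1 / real k ^ 3))) \<in> O(\<lambda>k. 1 / real k ^ 2)"
      by (intro sum_in_bigo(1)[OF landau_o.big.trans[OF upper_coeff_diff_lower_coeff inverse_power_bigo_mono]]
            sum_in_bigo(2) cmult_inverse_power_bigo) auto
    thus "(\<lambda>k. upper_coeff k l - lower_coeff k l) \<in> O(\<lambda>k. 1 / real k ^ 2)" by simp
  qed
  moreover have "fam_bigo N 2 (\<lambda>k. zero_eq_fps k N (wfps k))"
    by (intro fam_bigo_dvd wfps_equation)
  ultimately have "fam_bigo N 2 (\<lambda>k. inverse (H k) * (zero_eq_fps k N (wfps k) - S k))"
    by (intro fam_bigo_mult_0 fam_bigo_diff inverse_bounded H H0)
  moreover have "inverse (H k) * (zero_eq_fps k N (wfps k) - S k) = wfps_dev k" if k: "k \<ge> 1" for k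
  proof -
    have "wfps k ^ n - 1 = wfps_dev k * (\<Sum>i<n. wfps k ^ i)" for n
      unfolding wfps_dev_def by (rule power_diff_1_eq)
    moreover have "V k ^ n - 1 = - (wfps_dev k * V k) * (\<Sum>i<n. V k ^ i)" for n
    proof -
      have "V k - 1 = - (wfps_dev k * V k)"
        using wfps_inverse[OF k] by (simp add: wfps_dev_def V_def algebra_simps)
      thus ?thesis by (simp add: power_diff_1_eq)
    qed
    ultimately have "fps_const (upper_coeff k l) * wfps k ^ (l + 1) - fps_const (lower_coeff k l) * V k ^ l
        - fps_const (upper_coeff k l - lower_coeff k l) = wfps_dev k * G k l" for l
    proof -
      assume *: "\<And>n. wfps k ^ n - 1 = wfps_dev k * (\<Sum>i<n. wfps k ^ i)"
        "\<And>n. V k ^ n - 1 = - (wfps_dev k * V k) * (\<Sum>i<n. V k ^ i)"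
      have "fps_const (upper_coeff k l) * wfps k ^ (l + 1) - fps_const (lower_coeff k l) * V k ^ l - fps_const (upper_coeff k l - lower_coeff k l)
         = fps_const (upper_coeff k l) * (wfps k ^ (l + 1) - 1) - fps_const (lower_coeff k l) * (V k ^ l - 1)"
        by (simp add: algebra_simps fps_const_sub[symmetric] del: fps_const_sub)
      also have "\<dots> = wfps_dev k * G k l" unfolding * G_def by (simp add: algebra_simps)
      finally show ?thesis .
    qed
    hence "zero_eq_fps k N (wfps k) - S k = H k * wfps_dev k"
      unfolding zero_eq_fps_theta_term S_def H_def V_def[symmetric] sum_subtractf[symmetric] sum_distrib_right
        right_diff_distrib[symmetric]
      by (simp add: mult_ac)
    moreover have "inverse (H k) * H k = 1" using H0[OF k] by (simp add: inverse_mult_eq_1)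
    ultimately show ?thesis by (simp flip: mult.assoc)
  qed
  ultimately show ?thesis by (rule fam_bigo_cong[rotated])
qed

text \<open>Rests on 1/w - 1 + (w - 1) = (w - 1)^2 / w.\<close>

lemma inverse_wfps_linear: "fam_bigo N 4 (\<lambda>k. inverse (wfps k) - 1 + wfps_dev k)"
proof -
  have "fam_bigo N 4 (\<lambda>k. inverse (wfps k) * (wfps_dev k * wfps_dev k))"
    using fam_bigo_mult[OF wfps_dev_bigo wfps_dev_bigo]
    by (intro fam_bigo_mult_0[OF inverse_bounded[OF wfps_bounded wfps_nth_0]]) simp_all
  moreover have "inverse (wfps k) * (wfps_dev k * wfps_dev k) = inverse (wfps k) - 1 + wfps_dev k" if "k \<ge> 1" for k
    using wfps_inverse[OF that] by (simp add: wfps_dev_def algebra_simps)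
  ultimately show ?thesis by (rule fam_bigo_cong[rotated])
qed

lemma wfps_power_linear: "fam_bigo N 4 (\<lambda>k. wfps k ^ n - 1 - of_nat n * wfps_dev k)"
  using fam_bigo_power_linear[OF wfps_dev_bigo] by (simp add: wfps_dev_def)

lemma inverse_wfps_power_linear: "fam_bigo N 4 (\<lambda>k. inverse (wfps k) ^ n - 1 + of_nat n * wfps_dev k)"
proof -
  have "fam_bigo N 2 (\<lambda>k. (inverse (wfps k) - 1 + wfps_dev k) - wfps_dev k)"
    by (intro fam_bigo_diff wfps_dev_bigo fam_bigo_mono[OF inverse_wfps_linear]) simp
  hence "fam_bigo N 4 (\<lambda>k. inverse (wfps k) ^ n - 1 - of_nat n * (inverse (wfps k) - 1))"
    using fam_bigo_power_linear[of N "\<lambda>k. inverse (wfps k) - 1" n] by simp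
  moreover have "fam_bigo N 4 (\<lambda>k. of_nat n * (inverse (wfps k) - 1 + wfps_dev k))"
    by (intro fam_bigo_mult_0 fam_bigo_const inverse_wfps_linear)
  ultimately have "fam_bigo N 4 (\<lambda>k. (inverse (wfps k) ^ n - 1 - of_nat n * (inverse (wfps k) - 1)) + of_nat n * (inverse (wfps k) - 1 + wfps_dev k))"
    by (rule fam_bigo_add)
  thus ?thesis by (simp add: algebra_simps)
qed

lemma euler_sum: "euler (\<Sum>x\<in>S. f x) = (\<Sum>x\<in>S. euler (f x))"
  by (rule fps_ext) (simp add: euler_nth fps_sum_nth sum_distrib_left)

lemma euler_const_mult: "euler (fps_const c * f) = fps_const c * euler f"
  by (rule fps_ext) (simp add: euler_nth)

lemma euler_theta_term: "euler (theta_term l) = fps_const (real (tri l)) * theta_term l"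
  by (rule fps_ext, cases "even l") (auto simp: euler_nth theta_term_def)

lemma theta_fps_theta_term: "theta_fps N = (\<Sum>l\<le>N. fps_const (2 * real l + 1) * theta_term l)"
proof -
  have "of_nat (2 * l + 1) = fps_const (2 * real l + 1)" for l
    by (simp only: fps_of_nat[symmetric]) simp
  thus ?thesis by (simp only: theta_fps_def theta_term_def)
qed

lemma euler_theta_theta_term: "euler (theta_fps N) = (\<Sum>l\<le>N. fps_const ((2 * real l + 1) * real (tri l)) * theta_term l)"
  unfolding theta_fps_theta_term euler_sum euler_const_mult euler_theta_term mult.assoc[symmetric] fps_const_mult ..

lemma euler_euler_theta_theta_term:
  "euler (euler (theta_fps N)) = (\<Sum>l\<le>N. fps_const ((2 * real l + 1) * real (tri l) ^ 2) * theta_term l)"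
  unfolding euler_theta_theta_term euler_sum euler_const_mult euler_theta_term mult.assoc[symmetric] fps_const_mult power2_eq_square ..

definition inv_k :: "nat \<Rightarrow> real fps" where "inv_k k = fps_const (1 / real k)"

lemma inv_k_power: "inv_k k ^ j = fps_const (1 / real k ^ j)"
  by (simp add: inv_k_def fps_const_power power_one_over)

lemma inv_k_power_bigo: "fam_bigo N j (\<lambda>k. inv_k k ^ j)"
  unfolding inv_k_power by (rule fam_bigo_fps_const) simp

text \<open>\<open>R k l\<close> gathers the four errors of the l-th term: linearising the two
  powers of w, expanding A_l - B_l, and expanding the factor of w - 1. Each is O(k^-4). The equation
  is multiplied by 3 to clear denominators, and the sums over l become derivatives of the theta
  series.\<close>

lemma linearised_equation:
  "fam_bigo N 4 (\<lambda>k. inv_k k ^ 2 * euler (theta_fps N) - inv_k k ^ 3 * euler (euler (theta_fps N))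
     + 3 * wfps_dev k * (theta_fps N - inv_k k * euler (theta_fps N)))"
proof -
  define V where "V k = inverse (wfps k)" for k
  define c where "c k l = (2 * real l + 1) * real (tri l) / 3 * (1 / real k ^ 2)
       - (2 * real l + 1) * real (tri l) ^ 2 / 3 * (1 / real k ^ 3)" for k l
  define d where "d k l = (2 * real l + 1) * (1 - real (tri l) * (1 / real k))" for k l
  define R where "R k l = fps_const (upper_coeff k l) * (wfps k ^ (l + 1) - 1 - of_nat (l + 1) * wfps_dev k)
      - fps_const (lower_coeff k l) * (V k ^ l - 1 + of_nat l * wfps_dev k)
      + fps_const (upper_coeff k l - lower_coeff k l - c k l)
      + fps_const ((real l + 1) * upper_coeff k l + real l * lower_coeff k l - d k l) * wfps_dev k" for k l
  have "fam_bigo N 4 (\<lambda>k. R k l)" for l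
    unfolding R_def V_def
  proof (intro fam_bigo_add fam_bigo_diff)
    show "fam_bigo N 4 (\<lambda>k. fps_const (upper_coeff k l) * (wfps k ^ (l + 1) - 1 - of_nat (l + 1) * wfps_dev k))"
      by (intro fam_bigo_mult_0[OF upper_coeff_fam] wfps_power_linear)
    show "fam_bigo N 4 (\<lambda>k. fps_const (lower_coeff k l) * (inverse (wfps k) ^ l - 1 + of_nat l * wfps_dev k))"
      by (intro fam_bigo_mult_0[OF lower_coeff_fam] inverse_wfps_power_linear)
    show "fam_bigo N 4 (\<lambda>k. fps_const (upper_coeff k l - lower_coeff k l - c k l))"
      unfolding c_def by (intro fam_bigo_fps_const upper_coeff_diff_lower_coeff)
    have "fam_bigo N 2 (\<lambda>k. fps_const ((real l + 1) * upper_coeff k l + real l * lower_coeff k l - d k l))"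
      unfolding d_def by (intro fam_bigo_fps_const upper_coeff_lower_coeff_weighted)
    from fam_bigo_mult[OF this wfps_dev_bigo]
    show "fam_bigo N 4 (\<lambda>k. fps_const ((real l + 1) * upper_coeff k l + real l * lower_coeff k l - d k l) * wfps_dev k)" by simp
  qed
  hence "fam_bigo N 4 (\<lambda>k. 3 * (zero_eq_fps k N (wfps k) - (\<Sum>l\<le>N. theta_term l * R k l)))"
    by (intro fam_bigo_mult_0[OF fam_bigo_const] fam_bigo_diff fam_bigo_sum
          fam_bigo_dvd[of N "\<lambda>k. zero_eq_fps k N (wfps k)"] wfps_equation)
  moreover have "3 * (zero_eq_fps k N (wfps k) - (\<Sum>l\<le>N. theta_term l * R k l)) =
      inv_k k ^ 2 * euler (theta_fps N) - inv_k k ^ 3 * euler (euler (theta_fps N))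
     + 3 * wfps_dev k * (theta_fps N - inv_k k * euler (theta_fps N))" for k
  proof -
    have three: "3 = fps_const (3 :: real)" by (simp add: fps_numeral_fps_const)
    have summand: "fps_const (upper_coeff k l) * wfps k ^ (l + 1) - fps_const (lower_coeff k l) * V k ^ l - R k l
        = fps_const (c k l) + fps_const (d k l) * wfps_dev k" for l
    proof -
      have n: "of_nat (l + 1) = fps_const (real l + 1)" "of_nat l = fps_const (real l)"
        by (simp_all only: fps_of_nat[symmetric]) simp
      have "fps_const (upper_coeff k l - lower_coeff k l - c k l) = fps_const (upper_coeff k l) - fps_const (lower_coeff k l) - fps_const (c k l)"
        "fps_const ((real l + 1) * upper_coeff k l + real l * lower_coeff k l - d k l)
          = fps_const (real l + 1) * fps_const (upper_coeff k l) + fps_const (real l) * fps_const (lower_coeff k l) - fps_const (d k l)"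
        by simp_all
      moreover have "x * X - y * Y - (x * (X - 1 - m * e) - y * (Y - 1 + m' * e) + (x - y - c')
          + (m * x + m' * y - d') * e) = c' + d' * e" for x y X Y m m' e c' d' :: "real fps"
        by (simp add: algebra_simps)
      ultimately show ?thesis unfolding R_def n by (simp only:)
    qed
    have "3 * (zero_eq_fps k N (wfps k) - (\<Sum>l\<le>N. theta_term l * R k l)) =
       (\<Sum>l\<le>N. 3 * (theta_term l * (fps_const (c k l) + fps_const (d k l) * wfps_dev k)))"
      unfolding zero_eq_fps_theta_term V_def[symmetric] sum_subtractf[symmetric] right_diff_distrib[symmetric] summand sum_distrib_left ..
    also have "\<dots> = (\<Sum>l\<le>N. inv_k k ^ 2 * (fps_const ((2 * real l + 1) * real (tri l)) * theta_term l)
        - inv_k k ^ 3 * (fps_const ((2 * real l + 1) * real (tri l) ^ 2) * theta_term l)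
        + 3 * wfps_dev k * (fps_const (2 * real l + 1) * theta_term l - inv_k k * (fps_const ((2 * real l + 1) * real (tri l)) * theta_term l)))"
    proof (intro sum.cong refl)
      fix l
      have c: "3 * fps_const (c k l) = inv_k k ^ 2 * fps_const ((2 * real l + 1) * real (tri l)) - inv_k k ^ 3 * fps_const ((2 * real l + 1) * real (tri l) ^ 2)"
      proof -
        have "3 * (x / 3 * y - z / 3 * t) = y * x - t * z" for x y z t :: real by (simp add: algebra_simps)
        thus ?thesis unfolding inv_k_power three fps_const_mult fps_const_sub c_def by (simp only:)
      qed
      have d: "fps_const (d k l) = fps_const (2 * real l + 1) - inv_k k * fps_const ((2 * real l + 1) * real (tri l))"
        unfolding inv_k_def fps_const_mult fps_const_sub d_def by (intro arg_cong[where f = fps_const]) (simp add: algebra_simps)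
      have "3 * (theta_term l * (fps_const (c k l) + fps_const (d k l) * wfps_dev k)) = theta_term l * (3 * fps_const (c k l)) + 3 * wfps_dev k * (theta_term l * fps_const (d k l))"
        by (simp only: algebra_simps)
      also have "\<dots> = inv_k k ^ 2 * (fps_const ((2 * real l + 1) * real (tri l)) * theta_term l)
        - inv_k k ^ 3 * (fps_const ((2 * real l + 1) * real (tri l) ^ 2) * theta_term l)
        + 3 * wfps_dev k * (fps_const (2 * real l + 1) * theta_term l - inv_k k * (fps_const ((2 * real l + 1) * real (tri l)) * theta_term l))"
        unfolding c d by (simp only: right_diff_distrib mult.assoc mult.commute mult.left_commute)
      finally show "3 * (theta_term l * (fps_const (c k l) + fps_const (d k l) * wfps_dev k)) = \<dots>" .
    qed
    also have "\<dots> = inv_k k ^ 2 * euler (theta_fps N) - inv_k k ^ 3 * euler (euler (theta_fps N))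
     + 3 * wfps_dev k * (theta_fps N - inv_k k * euler (theta_fps N))"
      unfolding euler_euler_theta_theta_term unfolding euler_theta_theta_term unfolding theta_fps_theta_term
      by (simp only: sum.distrib sum_subtractf sum_distrib_left[symmetric])
    finally show ?thesis .
  qed
  ultimately show ?thesis by simp
qed

text \<open>Inserting \<theta>J = -3uJ and \<theta>(\<theta>J) = -3(\<theta>u)J + 9u^2 J and
  dividing by 3J gives (w - 1)(1 + 3eu) = e^2 u - e^3 \<theta>u + 3e^3 u^2 + O(e^4) with e = 1/k;
  \<open>Y\<close> is the difference of the two sides.\<close>

lemma wfps_dev_expansion:
  "fam_bigo N 4 (\<lambda>k. wfps_dev k - inv_k k ^ 2 * sigma_fps + inv_k k ^ 3 * euler sigma_fps)"
proof -
  define J where "J = theta_fps N"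
  define u where "u = sigma_fps"
  define j0 where "j0 = euler J + 3 * u * J"
  define j1 where "j1 = euler j0"
  define Y where "Y k = wfps_dev k * (1 + 3 * inv_k k * u) - inv_k k ^ 2 * u + inv_k k ^ 3 * euler u - 3 * inv_k k ^ 3 * u ^ 2" for k
  have j0: "fps_X ^ Suc N dvd j0" unfolding j0_def J_def u_def by (rule euler_theta)
  have j1: "fps_X ^ Suc N dvd j1" unfolding j1_def by (intro euler_dvd j0)
  have e1: "euler J = j0 - 3 * u * J" by (simp add: j0_def)
  have e2: "euler (euler J) = j1 - 3 * euler u * J - 3 * u * euler J"
  proof -
    have "euler (3 * u * J) = 3 * euler u * J + 3 * u * euler J"
      using euler_const_mult[of 3 "u * J"] by (simp add: euler_mult fps_numeral_fps_const[symmetric] algebra_simps)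
    thus ?thesis by (simp add: j1_def j0_def euler_add)
  qed
  have J0: "J $ 0 = 1"
  proof -
    have "(of_nat (2 * j + 1) * ((-1) ^ j * fps_X ^ tri j)) $ 0 = (if j = 0 then 1 else 0 :: real)" for j
      using le_tri[of j] by (cases "j = 0"; cases "even j") (auto simp: fps_mult_nth_0)
    thus ?thesis unfolding J_def theta_fps_def fps_sum_nth by simp
  qed
  let ?R = "\<lambda>k. inv_k k ^ 2 * euler J - inv_k k ^ 3 * euler (euler J) + 3 * wfps_dev k * (J - inv_k k * euler J)"
  \<comment> \<open>What the truncation of Jacobi's identity leaves behind; divisible by q^(N+1),
    hence invisible in coefficients up to N.\<close>
  let ?junk = "\<lambda>k. inv_k k ^ 2 * j0 - inv_k k ^ 3 * j1 + 3 * inv_k k ^ 3 * u * j0 - 3 * wfps_dev k * inv_k k * j0"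
  have RY: "?R k - ?junk k = 3 * J * Y k" for k
    unfolding e2 unfolding e1 Y_def by (simp add: algebra_simps power2_eq_square power3_eq_cube)
  have "fam_bigo N 4 ?junk"
    by (intro fam_bigo_dvd dvd_diff dvd_add dvd_mult j0 j1)
  hence "fam_bigo N 4 (\<lambda>k. ?R k - ?junk k)"
    using linearised_equation[of N] unfolding J_def by (rule fam_bigo_diff[rotated])
  hence "fam_bigo N 4 (\<lambda>k. (fps_const (1 / 3) * inverse J) * (3 * J * Y k))"
    unfolding RY by (rule fam_bigo_mult_0[OF fam_bigo_const])
  also have "(\<lambda>k. (fps_const (1 / 3) * inverse J) * (3 * J * Y k)) = Y"
  proof
    fix k
    have "fps_const (1 / 3) * 3 = (1 :: real fps)" by (simp add: fps_numeral_fps_const)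
    moreover have "inverse J * J = 1" using J0 by (simp add: inverse_mult_eq_1)
    ultimately have "(fps_const (1 / 3) * 3) * (inverse J * J) * Y k = Y k" by simp
    thus "(fps_const (1 / 3) * inverse J) * (3 * J * Y k) = Y k" by (simp only: mult_ac)
  qed
  finally have Y: "fam_bigo N 4 Y" .
  have e: "fam_bigo N 0 inv_k" using fam_bigo_mono[OF inv_k_power_bigo[of N 1], of 0] by simp
  \<comment> \<open>The factor 1 - 3eu inverts 1 + 3eu modulo e^2, which cancels the u^2 term at
    order e^3; \<open>t2\<close> and \<open>t3\<close> collect the remainder.\<close>
  have t1: "fam_bigo N 4 (\<lambda>k. (1 - 3 * inv_k k * u) * Y k)"
    by (intro fam_bigo_mult_0[OF _ Y] fam_bigo_diff fam_bigo_mult_0 fam_bigo_const e)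
  have t2: "fam_bigo N 4 (\<lambda>k. (3 * u * euler u - 9 * u ^ 3) * inv_k k ^ 4)"
    by (intro fam_bigo_mult_0[OF fam_bigo_const] inv_k_power_bigo)
  have "fam_bigo N (2 + 2) (\<lambda>k. inv_k k ^ 2 * wfps_dev k)"
    by (intro fam_bigo_mult inv_k_power_bigo wfps_dev_bigo)
  hence t3: "fam_bigo N 4 (\<lambda>k. 9 * u ^ 2 * (inv_k k ^ 2 * wfps_dev k))"
    by (intro fam_bigo_mult_0[OF fam_bigo_const]) simp
  have "(1 - 3 * inv_k k * u) * Y k + (3 * u * euler u - 9 * u ^ 3) * inv_k k ^ 4 + 9 * u ^ 2 * (inv_k k ^ 2 * wfps_dev k)
      = wfps_dev k - inv_k k ^ 2 * u + inv_k k ^ 3 * euler u" for k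
    unfolding Y_def by (simp add: algebra_simps power2_eq_square power3_eq_cube power4_eq_xxxx)
  with fam_bigo_add[OF fam_bigo_add[OF t1 t2] t3] show ?thesis by (simp only: u_def)
qed

section \<open>Asymptotics and numerators of the two coefficient families\<close>

lemma a_asymptotics:
  assumes "n \<ge> 1"
  shows "(\<lambda>k. a k n - real (sigma n) * (1 / real k ^ 2 - real n / real k ^ 3)) \<in> O(\<lambda>k. 1 / real k ^ 4)"
proof -
  have "(\<lambda>k. (wfps_dev k - inv_k k ^ 2 * sigma_fps + inv_k k ^ 3 * euler sigma_fps) $ n) \<in> O(\<lambda>k. 1 / real k ^ 4)"
    using wfps_dev_expansion[of n] by (simp add: fam_bigo_def)
  moreover have "(wfps_dev k - inv_k k ^ 2 * sigma_fps + inv_k k ^ 3 * euler sigma_fps) $ n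
      = a k n - real (sigma n) * (1 / real k ^ 2 - real n / real k ^ 3)" for k
    using assms by (simp add: inv_k_power wfps_dev_def wfps_def a_def euler_nth sigma_fps_def algebra_simps)
  ultimately show ?thesis by simp
qed

text \<open>1 - 1/w and w - 1 agree up to O(k^-4), which is why both numerators share their two
  leading coefficients.\<close>

lemma ahat_asymptotics:
  assumes "n \<ge> 1"
  shows "(\<lambda>k. ahat k n - real (sigma n) * (1 / real k ^ 2 - real n / real k ^ 3)) \<in> O(\<lambda>k. 1 / real k ^ 4)"
proof -
  have "(\<lambda>k. (inverse (wfps k) - 1 + wfps_dev k) $ n) \<in> O(\<lambda>k. 1 / real k ^ 4)"
    using inverse_wfps_linear[of n] by (simp add: fam_bigo_def)
  from sum_in_bigo(2)[OF a_asymptotics[OF assms] this]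
  show ?thesis
  proof (rule landau_o.big.in_cong[THEN iffD1, rotated], intro eventually_mono[OF eventually_ge_at_top[of 1]])
    fix k :: nat assume "k \<ge> 1"
    moreover have "(inverse (wfps k) - 1 + wfps_dev k) $ n = inverse (wfps k) $ n + wfps k $ n - 2 * (1 :: real fps) $ n"
      by (simp only: wfps_dev_def fps_add_nth fps_sub_nth)
    ultimately show "a k n - real (sigma n) * (1 / real k ^ 2 - real n / real k ^ 3) - (inverse (wfps k) - 1 + wfps_dev k) $ n
        = ahat k n - real (sigma n) * (1 / real k ^ 2 - real n / real k ^ 3)"
      using assms by (simp add: a_def ahat_def winvcoef_eq) (simp add: wfps_def)
  qed
qed

interpretation rational: graded_family rational_Q
  by (rule graded_rational_Q)

lemma a_rational: "rational_Q n (\<lambda>k. a k n)"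
  using rational.solution[OF wfps_nth_0 wfps_equation, of n]
  by (simp add: rational.fam_def wfps_def a_def)

lemma ahat_rational: "rational_Q n (\<lambda>k. ahat k n)"
proof -
  have "rational.fam n (\<lambda>k. inverse (wfps k))"
    by (intro rational.fam_inverse rational.solution wfps_nth_0 wfps_equation)
  hence "rational_Q n (\<lambda>k. - (inverse (wfps k) $ n))"
    by (intro rational.P_minus) (simp add: rational.fam_def)
  thus ?thesis by (rule rational.P_cong[rotated]) (simp add: ahat_def winvcoef_eq)
qed

lemma numerator_form:
  assumes n: "n \<ge> 2"
    and p: "\<And>k. k \<ge> 1 \<Longrightarrow> c k = real_of_int (poly p (int k)) / real_of_int (poly (Q n) (int k))"
    and c: "(\<lambda>k. c k - real (sigma n) * (1 / real k ^ 2 - real n / real k ^ 3)) \<in> O(\<lambda>k. 1 / real k ^ 4)"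
  shows "degree p = M n - 2 \<and> coeff p (M n - 2) = int (sigma n) \<and>
     coeff p (M n - 3) = int (sigma n) * (int (mu 1 n) - int n)"
proof -
  have "(\<lambda>k. real_of_int (poly p (int k)) / real_of_int (poly (Q n) (int k))
      - of_int (int (sigma n)) * (1 / real k ^ 2 - real n / real k ^ 3)) \<in> O(\<lambda>k. 1 / real k ^ 4)"
    using c by (rule landau_o.big.in_cong[THEN iffD1, rotated])
      (auto intro!: eventually_mono[OF eventually_ge_at_top[of 1]] simp: p)
  from numerator_coeffs[OF n _ this] show ?thesis using sigma_pos[of n] n by simp
qed

theorem theorem3:
  shows "(\<exists>P Ph :: nat \<Rightarrow> int poly.
            (\<forall>k\<ge>1. \<forall>n\<ge>1.
               a k n = real_of_int (poly (P n) (int k)) / real_of_int (poly (Q n) (int k)) \<and>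
               ahat k n = real_of_int (poly (Ph n) (int k)) / real_of_int (poly (Q n) (int k))) \<and>
            (\<forall>n\<ge>2. \<forall>R\<in>{P n, Ph n}.
               degree R = M n - 2 \<and>
               coeff R (M n - 2) = int (sigma n) \<and>
               coeff R (M n - 3) = int (sigma n) * (int (mu 1 n) - int n)))
      \<and> (\<forall>n\<ge>1. degree (Q n) = M n \<and> M n < 3 * n)
      \<and> (\<lambda>n. real (M n) / real n) \<longlonglongrightarrow> 3
      \<and> int (sigma 2) * (int (mu 1 2) - 2) = 0
      \<and> (\<forall>n\<ge>3. int (sigma n) * (int (mu 1 n) - int n) > 0)"
proof (intro conjI)
  obtain P where P: "\<And>n k. k \<ge> 1 \<Longrightarrow> a k n = real_of_int (poly (P n) (int k)) / real_of_int (poly (Q n) (int k))"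
    using a_rational unfolding rational_Q_def by metis
  obtain Ph where Ph: "\<And>n k. k \<ge> 1 \<Longrightarrow> ahat k n = real_of_int (poly (Ph n) (int k)) / real_of_int (poly (Q n) (int k))"
    using ahat_rational unfolding rational_Q_def by metis
  have "degree R = M n - 2 \<and> coeff R (M n - 2) = int (sigma n) \<and>
      coeff R (M n - 3) = int (sigma n) * (int (mu 1 n) - int n)" if "n \<ge> 2" "R \<in> {P n, Ph n}" for n R
    using that numerator_form[OF that(1) P a_asymptotics] numerator_form[OF that(1) Ph ahat_asymptotics] by auto
  with P Ph show "\<exists>P Ph :: nat \<Rightarrow> int poly.
            (\<forall>k\<ge>1. \<forall>n\<ge>1.
               a k n = real_of_int (poly (P n) (int k)) / real_of_int (poly (Q n) (int k)) \<and>
               ahat k n = real_of_int (poly (Ph n) (int k)) / real_of_int (poly (Q n) (int k))) \<and>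
            (\<forall>n\<ge>2. \<forall>R\<in>{P n, Ph n}.
               degree R = M n - 2 \<and>
               coeff R (M n - 2) = int (sigma n) \<and>
               coeff R (M n - 3) = int (sigma n) * (int (mu 1 n) - int n))"
    by blast
  show "\<forall>n\<ge>3. int (sigma n) * (int (mu 1 n) - int n) > 0"
    using sigma_pos mu_1_greater by simp
qed (use degree_Q M_less M_over_n_tendsto mu_1_2 in auto)

end
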